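(* Let $\Bbbk$ be a field and let $A$ be a Poisson algebra over $\Bbbk$ with trivial Poisson center. Then $A$ is universally Poisson cancellative.
   Context: A Poisson algebra over $\Bbbk$ is a commutative $\Bbbk$-algebra $A$ with a $\Bbbk$-bilinear bracket $\{\,,\}$ making $A$ a Lie algebra and such that $\{a,-\}$ is a $\Bbbk$-derivation of $A$ for every $a\in A$. Its Poisson center $\mathcal Z_P(A)=\{z\in A:\{z,a\}=0\ \forall a\in A\}$ is trivial if $\mathcal Z_P(A)=\Bbbk$. For Poisson algebras $A,R$, the bracket on $A\otimes R$ is $\{a_1\otimes r_1,a_2\otimes r_2\}=\{a_1,a_2\}\otimes r_1r_2+a_1a_2\otimes\{r_1,r_2\}$. $A$ is universally Poisson cancellative if, for every Poisson algebra $B$ over $\Bbbk$ and every finitely generated commutative domain $R$ over $\Bbbk$ with trivial Poisson bracket having an ideal $I\subset R$ such that the natural map $\Bbbk\to R\to R/I$ is an isomorphism, $A\otimes R\cong B\otimes R$ as Poisson algebras implies $A\cong B$ as Poisson algebras. *)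

theory Defs
  imports "HOL-Algebra.Module" "HOL-Algebra.QuotRing" "HOL-Algebra.Generated_Rings"
    "HOL-Algebra.Generated_Groups" "HOL-Algebra.Free_Abelian_Groups"
begin

section \<open>Poisson algebras\<close>

record ('k, 'a) poisson = "('k, 'a) module" +
  bracket :: "'a \<Rightarrow> 'a \<Rightarrow> 'a"  (\<open>\<lbrace>_,/ _\<rbrace>\<index>\<close>)

text \<open>
  The library locale \<open>algebra K A\<close> describes commutative unital algebras (the zero
  algebra included).  The Lie axiom is the alternating law, which in characteristic 2 is
  stronger than antisymmetry.
\<close>

locale poisson_algebra = K?: field K + algebra K A
  for K :: "('k, 'n) ring_scheme" (structure) and A :: "('k, 'a, 'm) poisson_scheme" (structure) +
  assumes bracket_closed:
      "\<lbrakk>a \<in> carrier A; b \<in> carrier A\<rbrakk> \<Longrightarrow> \<lbrace>a, b\<rbrace>\<^bsub>A\<^esub> \<in> carrier A"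
    and bracket_add_left:
      "\<lbrakk>a \<in> carrier A; b \<in> carrier A; c \<in> carrier A\<rbrakk>
        \<Longrightarrow> \<lbrace>a \<oplus>\<^bsub>A\<^esub> b, c\<rbrace>\<^bsub>A\<^esub> = \<lbrace>a, c\<rbrace>\<^bsub>A\<^esub> \<oplus>\<^bsub>A\<^esub> \<lbrace>b, c\<rbrace>\<^bsub>A\<^esub>"
    and bracket_add_right:
      "\<lbrakk>a \<in> carrier A; b \<in> carrier A; c \<in> carrier A\<rbrakk>
        \<Longrightarrow> \<lbrace>a, b \<oplus>\<^bsub>A\<^esub> c\<rbrace>\<^bsub>A\<^esub> = \<lbrace>a, b\<rbrace>\<^bsub>A\<^esub> \<oplus>\<^bsub>A\<^esub> \<lbrace>a, c\<rbrace>\<^bsub>A\<^esub>"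
    and bracket_smult_left:
      "\<lbrakk>k \<in> carrier K; a \<in> carrier A; b \<in> carrier A\<rbrakk>
        \<Longrightarrow> \<lbrace>k \<odot>\<^bsub>A\<^esub> a, b\<rbrace>\<^bsub>A\<^esub> = k \<odot>\<^bsub>A\<^esub> \<lbrace>a, b\<rbrace>\<^bsub>A\<^esub>"
    and bracket_smult_right:
      "\<lbrakk>k \<in> carrier K; a \<in> carrier A; b \<in> carrier A\<rbrakk>
        \<Longrightarrow> \<lbrace>a, k \<odot>\<^bsub>A\<^esub> b\<rbrace>\<^bsub>A\<^esub> = k \<odot>\<^bsub>A\<^esub> \<lbrace>a, b\<rbrace>\<^bsub>A\<^esub>"
    and bracket_self:
      "a \<in> carrier A \<Longrightarrow> \<lbrace>a, a\<rbrace>\<^bsub>A\<^esub> = \<zero>\<^bsub>A\<^esub>"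
    and bracket_jacobi:
      "\<lbrakk>a \<in> carrier A; b \<in> carrier A; c \<in> carrier A\<rbrakk>
        \<Longrightarrow> \<lbrace>a, \<lbrace>b, c\<rbrace>\<^bsub>A\<^esub>\<rbrace>\<^bsub>A\<^esub> \<oplus>\<^bsub>A\<^esub> \<lbrace>b, \<lbrace>c, a\<rbrace>\<^bsub>A\<^esub>\<rbrace>\<^bsub>A\<^esub> \<oplus>\<^bsub>A\<^esub> \<lbrace>c, \<lbrace>a, b\<rbrace>\<^bsub>A\<^esub>\<rbrace>\<^bsub>A\<^esub> = \<zero>\<^bsub>A\<^esub>"
    and bracket_leibniz:
      "\<lbrakk>a \<in> carrier A; b \<in> carrier A; c \<in> carrier A\<rbrakk>
        \<Longrightarrow> \<lbrace>a, b \<otimes>\<^bsub>A\<^esub> c\<rbrace>\<^bsub>A\<^esub> = \<lbrace>a, b\<rbrace>\<^bsub>A\<^esub> \<otimes>\<^bsub>A\<^esub> c \<oplus>\<^bsub>A\<^esub> b \<otimes>\<^bsub>A\<^esub> \<lbrace>a, c\<rbrace>\<^bsub>A\<^esub>"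

definition poisson_center :: "('k, 'a, 'm) poisson_scheme \<Rightarrow> 'a set"
  where "poisson_center A = {z \<in> carrier A. \<forall>a \<in> carrier A. \<lbrace>z, a\<rbrace>\<^bsub>A\<^esub> = \<zero>\<^bsub>A\<^esub>}"

text \<open>
  The equality of the Poisson center with the field \<open>K\<close> is read through the structure map
  \<open>k \<mapsto> k \<cdot> 1\<close>.  Requiring a bijection, not only that the image is the center, excludes the
  zero algebra, which does not contain \<open>K\<close>.
\<close>

definition trivial_poisson_center ::
    "('k, 'n) ring_scheme \<Rightarrow> ('k, 'a, 'm) poisson_scheme \<Rightarrow> bool"
  where "trivial_poisson_center K A \<longleftrightarrow>
    bij_betw (\<lambda>k. k \<odot>\<^bsub>A\<^esub> \<one>\<^bsub>A\<^esub>) (carrier K) (poisson_center A)"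

definition trivial_bracket :: "('k, 'a, 'm) poisson_scheme \<Rightarrow> bool"
  where "trivial_bracket A \<longleftrightarrow> (\<forall>a \<in> carrier A. \<forall>b \<in> carrier A. \<lbrace>a, b\<rbrace>\<^bsub>A\<^esub> = \<zero>\<^bsub>A\<^esub>)"

definition poisson_iso ::
    "('k, 'n) ring_scheme \<Rightarrow> ('k, 'a, 'm) poisson_scheme \<Rightarrow> ('k, 'b, 'l) poisson_scheme \<Rightarrow> ('a \<Rightarrow> 'b) set"
  where "poisson_iso K A B = {h \<in> ring_iso A B.
    (\<forall>k \<in> carrier K. \<forall>a \<in> carrier A. h (k \<odot>\<^bsub>A\<^esub> a) = k \<odot>\<^bsub>B\<^esub> h a) \<and>
    (\<forall>a \<in> carrier A. \<forall>b \<in> carrier A. h \<lbrace>a, b\<rbrace>\<^bsub>A\<^esub> = \<lbrace>h a, h b\<rbrace>\<^bsub>B\<^esub>)}"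

definition poisson_isomorphic ::
    "('k, 'n) ring_scheme \<Rightarrow> ('k, 'a, 'm) poisson_scheme \<Rightarrow> ('k, 'b, 'l) poisson_scheme \<Rightarrow> bool"
  where "poisson_isomorphic K A B \<longleftrightarrow> poisson_iso K A B \<noteq> {}"

section \<open>Tensor products of Poisson algebras\<close>

text \<open>
  \<open>A \<otimes> R\<close> is the free abelian group on \<open>A \<times> R\<close> modulo the subgroup generated by the
  bilinearity and balancing relations.  The operations are given on the free abelian group by
  additive extension from the generators \<open>(a, r)\<close>, and then passed to cosets as in the
  quotient ring of the library.
\<close>

definition tensor_relations ::
    "('k, 'n) ring_scheme \<Rightarrow> ('k, 'a, 'm) poisson_scheme \<Rightarrow> ('k, 'r, 'l) poisson_scheme
      \<Rightarrow> ('a \<times> 'r \<Rightarrow>\<^sub>0 int) set"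
  where "tensor_relations K A R =
    {frag_of (a \<oplus>\<^bsub>A\<^esub> b, r) - frag_of (a, r) - frag_of (b, r) | a b r.
      a \<in> carrier A \<and> b \<in> carrier A \<and> r \<in> carrier R} \<union>
    {frag_of (a, r \<oplus>\<^bsub>R\<^esub> s) - frag_of (a, r) - frag_of (a, s) | a r s.
      a \<in> carrier A \<and> r \<in> carrier R \<and> s \<in> carrier R} \<union>
    {frag_of (k \<odot>\<^bsub>A\<^esub> a, r) - frag_of (a, k \<odot>\<^bsub>R\<^esub> r) | k a r.
      k \<in> carrier K \<and> a \<in> carrier A \<and> r \<in> carrier R}"

definition free_smult ::
    "('k, 'a, 'm) poisson_scheme \<Rightarrow> 'k \<Rightarrow> ('a \<times> 'r \<Rightarrow>\<^sub>0 int) \<Rightarrow> ('a \<times> 'r \<Rightarrow>\<^sub>0 int)"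
  where "free_smult A k = frag_extend (\<lambda>(a, r). frag_of (k \<odot>\<^bsub>A\<^esub> a, r))"

definition free_mult ::
    "('k, 'a, 'm) poisson_scheme \<Rightarrow> ('k, 'r, 'l) poisson_scheme
      \<Rightarrow> ('a \<times> 'r \<Rightarrow>\<^sub>0 int) \<Rightarrow> ('a \<times> 'r \<Rightarrow>\<^sub>0 int) \<Rightarrow> ('a \<times> 'r \<Rightarrow>\<^sub>0 int)"
  where "free_mult A R x y =
    frag_extend (\<lambda>(a, r). frag_extend (\<lambda>(b, s). frag_of (a \<otimes>\<^bsub>A\<^esub> b, r \<otimes>\<^bsub>R\<^esub> s)) y) x"

definition free_bracket ::
    "('k, 'a, 'm) poisson_scheme \<Rightarrow> ('k, 'r, 'l) poisson_scheme
      \<Rightarrow> ('a \<times> 'r \<Rightarrow>\<^sub>0 int) \<Rightarrow> ('a \<times> 'r \<Rightarrow>\<^sub>0 int) \<Rightarrow> ('a \<times> 'r \<Rightarrow>\<^sub>0 int)"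
  where "free_bracket A R x y =
    frag_extend (\<lambda>(a, r). frag_extend (\<lambda>(b, s).
      frag_of (\<lbrace>a, b\<rbrace>\<^bsub>A\<^esub>, r \<otimes>\<^bsub>R\<^esub> s) + frag_of (a \<otimes>\<^bsub>A\<^esub> b, \<lbrace>r, s\<rbrace>\<^bsub>R\<^esub>)) y) x"

definition poisson_tensor ::
    "('k, 'n) ring_scheme \<Rightarrow> ('k, 'a, 'm) poisson_scheme \<Rightarrow> ('k, 'r, 'l) poisson_scheme
      \<Rightarrow> ('k, ('a \<times> 'r \<Rightarrow>\<^sub>0 int) set) poisson"
  where "poisson_tensor K A R =
    (let F = free_Abelian_group (carrier A \<times> carrier R);
         N = generate F (tensor_relations K A R)
     in \<lparr>carrier = carrier (F Mod N),
         monoid.mult = (\<lambda>X Y. \<Union>x\<in>X. \<Union>y\<in>Y. N #>\<^bsub>F\<^esub> free_mult A R x y),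
         one = N #>\<^bsub>F\<^esub> frag_of (\<one>\<^bsub>A\<^esub>, \<one>\<^bsub>R\<^esub>),
         ring.zero = \<one>\<^bsub>F Mod N\<^esub>,
         ring.add = monoid.mult (F Mod N),
         module.smult = (\<lambda>k X. \<Union>x\<in>X. N #>\<^bsub>F\<^esub> free_smult A k x),
         bracket = (\<lambda>X Y. \<Union>x\<in>X. \<Union>y\<in>Y. N #>\<^bsub>F\<^esub> free_bracket A R x y)\<rparr>)"

section \<open>Universal cancellation\<close>

definition finitely_generated_algebra ::
    "('k, 'n) ring_scheme \<Rightarrow> ('k, 'r, 'm) module_scheme \<Rightarrow> bool"
  where "finitely_generated_algebra K R \<longleftrightarrow>
    (\<exists>S. finite S \<and> S \<subseteq> carrier R \<and>
      generate_ring R ((\<lambda>k. k \<odot>\<^bsub>R\<^esub> \<one>\<^bsub>R\<^esub>) ` carrier K \<union> S) = carrier R)"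

text \<open>
  HOL cannot quantify over types inside a definition, so the types \<open>'b\<close> and \<open>'r\<close> of the
  elements of \<open>B\<close> and \<open>R\<close> are parameters.  A theorem in which they are free type variables
  therefore covers all \<open>B\<close> and \<open>R\<close>.
\<close>

definition universally_poisson_cancellative ::
    "'b itself \<Rightarrow> 'r itself \<Rightarrow> ('k, 'n) ring_scheme \<Rightarrow> ('k, 'a, 'm) poisson_scheme \<Rightarrow> bool"
  where "universally_poisson_cancellative _ _ K A \<longleftrightarrow>
    (\<forall>(B :: ('k, 'b) poisson) (R :: ('k, 'r) poisson).
      poisson_algebra K B \<and>
      poisson_algebra K R \<and> trivial_bracket R \<and> domain R \<and> finitely_generated_algebra K R \<and>
      (\<exists>I. ideal I R \<and> (\<lambda>k. I +>\<^bsub>R\<^esub> (k \<odot>\<^bsub>R\<^esub> \<one>\<^bsub>R\<^esub>)) \<in> ring_iso K (R Quot I)) \<and>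
      poisson_isomorphic K (poisson_tensor K A R) (poisson_tensor K B R)
      \<longrightarrow> poisson_isomorphic K A B)"

end

theory Submission
  imports Defs "HOL-Algebra.Ring_Divisibility"
begin

text \<open>
  Let \<open>\<phi>\<close> be an isomorphism from \<open>A \<otimes> R\<close> to \<open>B \<otimes> R\<close>, let \<open>\<psi>\<close> be its inverse, and let
  \<open>\<epsilon>\<close> be the augmentation of \<open>R\<close> with kernel \<open>I\<close>.  It induces the evaluation
  \<open>id \<otimes> \<epsilon>\<close> from \<open>A \<otimes> R\<close> to \<open>A\<close>, a Poisson homomorphism.  If \<open>\<phi>\<close> carries the subring
  \<open>1 \<otimes> R\<close> onto \<open>1 \<otimes> R\<close>, say \<open>\<phi>(1 \<otimes> r) = 1 \<otimes> \<rho> r\<close> with an automorphism \<open>\<rho>\<close> of \<open>R\<close>,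
  then it carries the kernel of \<open>id \<otimes> \<epsilon>\<close> onto the kernel of \<open>id \<otimes> \<epsilon>'\<close>, where
  \<open>\<epsilon>' = \<epsilon> \<circ> \<rho>\<^sup>-\<^sup>1\<close>, and passing to the quotients gives an isomorphism between \<open>A\<close> and \<open>B\<close>
  (lemma \<open>slice_transfer\<close>).  All the work is in finding \<open>\<rho>\<close>.

  The Poisson center of \<open>A \<otimes> R\<close> is \<open>1 \<otimes> R\<close> because that of \<open>A\<close> is the field
  (\<open>center_of_tensor\<close>), while on the other side \<open>1 \<otimes> R\<close> is central but the center could be
  larger.  Therefore \<open>\<psi>\<close> yields a ring endomorphism \<open>\<theta>\<close> of \<open>R\<close> with
  \<open>\<psi>(1 \<otimes> r) = 1 \<otimes> \<theta> r\<close>, and the point is that \<open>\<theta>\<close> is onto.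

  Put \<open>\<epsilon>' = \<epsilon> \<circ> \<theta>\<close>.  The Poisson homomorphism \<open>\<beta>\<close> from \<open>B\<close> to \<open>A\<close>, which sends \<open>b\<close> to
  the value of \<open>id \<otimes> \<epsilon>\<close> at \<open>\<psi>(b \<otimes> 1)\<close>, is onto.  Hence \<open>\<beta> \<otimes> id\<close>, from \<open>B \<otimes> R\<close> to
  \<open>A \<otimes> R\<close>, is onto as well, so \<open>(\<beta> \<otimes> id) \<circ> \<phi>\<close> maps the center \<open>1 \<otimes> R\<close> of \<open>A \<otimes> R\<close> into
  itself.  The ring endomorphism \<open>\<rho>\<close> of \<open>R\<close> obtained in this way satisfies \<open>\<rho> \<circ> \<theta> = id\<close>,
  since \<open>\<beta> 1 = 1\<close>.  It is a surjective endomorphism of a Noetherian ring and so injective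
  (\<open>surjective_endomorphism_inj\<close>); thus \<open>\<theta>\<close> is the inverse of \<open>\<rho>\<close>.

  That \<open>R\<close> is Noetherian follows from its finite generation by Hilbert's basis theorem
  (\<open>Hilbert_basis\<close>).  The center of \<open>A \<otimes> R\<close> is computed by applying \<open>id \<otimes> \<lambda>\<close> for all linear
  functionals \<open>\<lambda>\<close> on \<open>R\<close>; the functionals come from Zorn's lemma (\<open>separating_functional\<close>).
\<close>

section \<open>Noetherian rings\<close>

lemma (in cring) idealI_comm:
  assumes "I \<subseteq> carrier R" "\<zero> \<in> I"
    and "\<And>a b. \<lbrakk>a \<in> I; b \<in> I\<rbrakk> \<Longrightarrow> a \<oplus> b \<in> I"
    and "\<And>r a. \<lbrakk>r \<in> carrier R; a \<in> I\<rbrakk> \<Longrightarrow> r \<otimes> a \<in> I"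
  shows "ideal I R"
proof (rule idealI)
  show "ring R" by (rule ring_axioms)
  show "subgroup I (add_monoid R)"
  proof (rule group.subgroupI)
    show "group (add_monoid R)" by (rule a_group)
    fix a assume a: "a \<in> I"
    then have "(\<ominus> \<one>) \<otimes> a \<in> I" using assms(4) by blast
    moreover have "(\<ominus> \<one>) \<otimes> a = \<ominus> a"
      using a assms(1) by (simp add: l_minus subset_iff)
    ultimately show "inv\<^bsub>add_monoid R\<^esub> a \<in> I" by (simp add: a_inv_def)
  qed (use assms in auto)
qed (use assms m_comm in \<open>(metis subsetD)+\<close>)

lemma (in noetherian_ring) ascending_ideals_stabilize:
  fixes I :: "nat \<Rightarrow> 'a set"
  assumes I: "\<And>n. ideal (I n) R" and mono: "\<And>n. I n \<subseteq> I (Suc n)"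
  shows "\<exists>N. \<forall>n \<ge> N. I n = I N"
proof -
  have le: "I m \<subseteq> I n" if "m \<le> n" for m n
    using lift_Suc_mono_le[of I, OF mono that] .
  have "subset.chain {I. ideal I R} (range I)"
    unfolding subset_chain_def
  proof (intro conjI ballI)
    fix X Y assume "X \<in> range I" "Y \<in> range I"
    then obtain m n where "X = I m" "Y = I n" by blast
    then show "X \<subseteq> Y \<or> Y \<subseteq> X" using le nat_le_linear[of m n] by blast
  qed (use I in blast)
  then have "\<Union>(range I) \<in> range I"
    by (intro ideal_chain_is_trivial) auto
  then obtain N where "\<Union>(range I) = I N" by auto
  then have "I n = I N" if "n \<ge> N" for n
    using le[OF that] by auto
  then show ?thesis by blast
qed

text \<open>
  If an ideal \<open>J\<close> is not finitely generated, then the ideal generated by a finite subset of \<open>J\<close>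
  always grows when a suitable further element of \<open>J\<close> is added.  Dependent choice turns this
  into a strictly ascending sequence of ideals.
\<close>

lemma (in ring) noetherian_if_ascending_ideals_stabilize:
  assumes "\<And>I :: nat \<Rightarrow> 'a set. \<lbrakk>\<And>n. ideal (I n) R; \<And>n. I n \<subseteq> I (Suc n)\<rbrakk>
      \<Longrightarrow> \<exists>N. I (Suc N) = I N"
  shows "noetherian_ring R"
proof (rule noetherian_ringI, rule ccontr)
  fix J assume J: "ideal J R" and nfg: "\<not> (\<exists>A \<subseteq> carrier R. finite A \<and> J = Idl A)"
  have JR: "J \<subseteq> carrier R"
    using J additive_subgroup.a_subset ideal.axioms(1) by blast
  define P where "P n A \<longleftrightarrow> finite A \<and> A \<subseteq> J" for n :: nat and A
  have ex: "\<exists>B. P (Suc n) B \<and> Idl A \<subset> Idl B" if A: "P n A" for n A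
  proof -
    have "Idl A \<subseteq> J" using A J genideal_minimal P_def by blast
    moreover have "Idl A \<noteq> J" using A nfg JR P_def by blast
    ultimately obtain a where a: "a \<in> J" "a \<notin> Idl A" by blast
    have sub: "insert a A \<subseteq> carrier R" using a A JR P_def by blast
    have "Idl A \<subseteq> Idl (insert a A)"
      using sub by (meson genideal_ideal genideal_minimal genideal_self insert_subset subset_trans)
    moreover have "a \<in> Idl (insert a A)"
      using genideal_self[OF sub] by blast
    ultimately show ?thesis
      using a A by (intro exI[of _ "insert a A"]) (auto simp: P_def)
  qed
  have "P 0 {}" by (simp add: P_def)
  then obtain A where A: "\<And>n. P n (A n)" "\<And>n. Idl (A n) \<subset> Idl (A (Suc n))"
    using dependent_nat_choice[of P "\<lambda>_ A B. Idl A \<subset> Idl B"] ex by metis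
  have "\<exists>N. Idl (A (Suc N)) = Idl (A N)"
  proof (rule assms)
    show "ideal (Idl (A n)) R" for n
      using A(1)[of n] JR genideal_ideal P_def by blast
  qed (use A(2) in blast)
  then show False using A(2) by blast
qed

context cring
begin

text \<open>
  The values at \<open>x\<close> of the polynomials of degree less than \<open>n\<close> with coefficients in \<open>S\<close>.
  Working with these subsets of \<open>R\<close> gives the basis theorem directly for a ring generated by
  \<open>S\<close> and \<open>x\<close>, which is how it is applied; a polynomial ring and its quotients do not occur.
\<close>

primrec polys :: "'a set \<Rightarrow> 'a \<Rightarrow> nat \<Rightarrow> 'a set" where
  polys_0: "polys S x 0 = {\<zero>}"
| polys_Suc: "polys S x (Suc m) = {p \<oplus> s \<otimes> x [^] m | p s. p \<in> polys S x m \<and> s \<in> S}"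

declare polys.simps [simp del]

lemma polys_SucI: "\<lbrakk>p \<in> polys S x m; s \<in> S\<rbrakk> \<Longrightarrow> p \<oplus> s \<otimes> x [^] m \<in> polys S x (Suc m)"
  by (auto simp: polys_Suc)

context
  fixes S x
  assumes S: "subring S R" and x: "x \<in> carrier R"
begin

private lemma S_carrier: "s \<in> S \<Longrightarrow> s \<in> carrier R"
  using subringE(1)[OF S] by blast

lemma polys_carrier: "p \<in> polys S x n \<Longrightarrow> p \<in> carrier R"
  by (induction n arbitrary: p) (auto simp: polys_0 polys_Suc S_carrier x)

lemma polys_step: "p \<in> polys S x n \<Longrightarrow> p \<in> polys S x (Suc n)"
  using polys_SucI[of p S x n "\<zero>"] subringE(2)[OF S] x polys_carrier[of p n] by simp

lemma polys_mono: "\<lbrakk>m \<le> n; p \<in> polys S x m\<rbrakk> \<Longrightarrow> p \<in> polys S x n"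
  by (induction rule: dec_induct) (auto intro: polys_step)

lemma polys_add: "\<lbrakk>p \<in> polys S x n; q \<in> polys S x n\<rbrakk> \<Longrightarrow> p \<oplus> q \<in> polys S x n"
proof (induction n arbitrary: p q)
  case (Suc n)
  then obtain p' s q' t where *: "p = p' \<oplus> s \<otimes> x [^] n" "p' \<in> polys S x n" "s \<in> S"
    "q = q' \<oplus> t \<otimes> x [^] n" "q' \<in> polys S x n" "t \<in> S"
    by (auto simp: polys_Suc)
  then have c: "p' \<in> carrier R" "q' \<in> carrier R" "s \<in> carrier R" "t \<in> carrier R" "x [^] n \<in> carrier R"
    using polys_carrier S_carrier x by auto
  have "p \<oplus> q = (p' \<oplus> q') \<oplus> (s \<oplus> t) \<otimes> x [^] n"
    unfolding * using c by algebra
  then show ?case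
    using polys_SucI[OF Suc.IH[OF *(2,5)] subringE(7)[OF S *(3,6)]] by simp
qed (auto simp: polys_0)

lemma polys_smult: "\<lbrakk>s \<in> S; p \<in> polys S x n\<rbrakk> \<Longrightarrow> s \<otimes> p \<in> polys S x n"
proof (induction n arbitrary: p)
  case (Suc n)
  then obtain p' t where *: "p = p' \<oplus> t \<otimes> x [^] n" "p' \<in> polys S x n" "t \<in> S"
    by (auto simp: polys_Suc)
  then have c: "p' \<in> carrier R" "s \<in> carrier R" "t \<in> carrier R" "x [^] n \<in> carrier R"
    using polys_carrier S_carrier x Suc.prems by auto
  have "s \<otimes> p = s \<otimes> p' \<oplus> (s \<otimes> t) \<otimes> x [^] n"
    unfolding * using c by algebra
  then show ?case
    using polys_SucI[OF Suc.IH[OF Suc.prems(1) *(2)] subringE(6)[OF S Suc.prems(1) *(3)]] by simp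
qed (auto simp: polys_0 S_carrier)

lemma polys_shift: "p \<in> polys S x n \<Longrightarrow> x \<otimes> p \<in> polys S x (Suc n)"
proof (induction n arbitrary: p)
  case (Suc n)
  then obtain p' t where *: "p = p' \<oplus> t \<otimes> x [^] n" "p' \<in> polys S x n" "t \<in> S"
    by (auto simp: polys_Suc[of S x n])
  then have c: "p' \<in> carrier R" "t \<in> carrier R" "x [^] n \<in> carrier R"
    using polys_carrier S_carrier x by auto
  have "x \<otimes> p = x \<otimes> p' \<oplus> t \<otimes> (x [^] n \<otimes> x)"
    unfolding * using c x by algebra
  then show ?case
    using polys_SucI[OF Suc.IH[OF *(2)] *(3)] by simp
next
  case 0
  then show ?case using x polys_step[of \<zero> 0] by (simp add: polys_0)
qed

lemma polys_mult:
  assumes "p \<in> polys S x m" "q \<in> polys S x n"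
  shows "\<exists>k. p \<otimes> q \<in> polys S x k"
  using assms(1)
proof (induction m arbitrary: p)
  case 0
  then show ?case using assms(2) polys_carrier by (auto simp: polys_0 intro!: exI[of _ 0])
next
  case (Suc m)
  then obtain p' s where *: "p = p' \<oplus> s \<otimes> x [^] m" "p' \<in> polys S x m" "s \<in> S"
    by (auto simp: polys_Suc)
  then have c: "p' \<in> carrier R" "s \<in> carrier R" "x [^] m \<in> carrier R" "q \<in> carrier R"
    using polys_carrier S_carrier x assms(2) by auto
  obtain k where k: "p' \<otimes> q \<in> polys S x k" using Suc.IH[OF *(2)] by blast
  have "x [^] m \<otimes> q \<in> polys S x (n + m)"
  proof (induction m)
    case 0
    then show ?case using assms(2) polys_carrier by auto
  next
    case (Suc m)
    have "x [^] Suc m \<otimes> q = x \<otimes> (x [^] m \<otimes> q)"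
      using x c(4) by (simp add: m_ac)
    then show ?case using polys_shift[OF Suc] by simp
  qed
  then have "s \<otimes> (x [^] m \<otimes> q) \<in> polys S x (n + m)"
    using polys_smult *(3) by blast
  moreover have "p \<otimes> q = p' \<otimes> q \<oplus> s \<otimes> (x [^] m \<otimes> q)"
    unfolding * using c by algebra
  ultimately have "p \<otimes> q \<in> polys S x (max k (n + m))"
    using polys_add polys_mono k by (metis max.cobounded1 max.cobounded2)
  then show ?case by blast
qed

lemma generate_ring_polys:
  assumes "p \<in> generate_ring R (insert x S)"
  shows "\<exists>n. p \<in> polys S x n"
  using assms
proof (induction rule: generate_ring.induct)
  have const: "s \<in> polys S x (Suc 0)" if "s \<in> S" for s
    using polys_SucI[of \<zero> S x 0 s] that S_carrier by (simp add: polys_0)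
  case one
  then show ?case using const subringE(3)[OF S] by blast
next
  have const: "s \<in> polys S x (Suc 0)" if "s \<in> S" for s
    using polys_SucI[of \<zero> S x 0 s] that S_carrier by (simp add: polys_0)
  case (incl h)
  moreover have "x \<in> polys S x (Suc (Suc 0))"
    using polys_shift[OF const[OF subringE(3)[OF S]]] x by simp
  ultimately show ?case using const by blast
next
  case (a_inv h)
  then obtain n where n: "h \<in> polys S x n" by blast
  have "\<ominus> \<one> \<in> S" using subringE(3,5)[OF S] by blast
  then have "(\<ominus> \<one>) \<otimes> h \<in> polys S x n" using n polys_smult by blast
  moreover have "(\<ominus> \<one>) \<otimes> h = \<ominus> h" using polys_carrier[OF n] by (simp add: l_minus)
  ultimately show ?case by auto
next
  case (eng_add g h)
  then show ?case
    using polys_add polys_mono by (metis max.cobounded1 max.cobounded2)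
next
  case (eng_mult g h)
  then show ?case using polys_mult by blast
qed

text \<open>
  The coefficients of \<open>x [^] n\<close> in the polynomial expressions of degree at most \<open>n\<close> whose value
  lies in \<open>I\<close>.  The coefficient may be zero, and the degree is fixed rather than maximal; this
  is what makes the set an ideal of \<open>S\<close>.
\<close>

definition lead :: "'a set \<Rightarrow> nat \<Rightarrow> 'a set"
  where "lead I n = {s \<in> S. \<exists>p \<in> polys S x n. p \<oplus> s \<otimes> x [^] n \<in> I}"

lemma lead_ideal:
  assumes I: "ideal I R"
  shows "ideal (lead I n) (R\<lparr>carrier := S\<rparr>)"
proof -
  interpret Q: cring "R\<lparr>carrier := S\<rparr>"
    using subcringI'[OF S] unfolding subcring_iff[OF subringE(1)[OF S]] .
  interpret I: ideal I R by fact
  show ?thesis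
  proof (rule Q.idealI_comm; simp)
    show "lead I n \<subseteq> S" by (auto simp: lead_def)
    have "\<zero> \<in> polys S x n" using polys_mono[of 0 n \<zero>] by (simp add: polys_0)
    moreover have "\<zero> \<oplus> \<zero> \<otimes> x [^] n \<in> I" using x I.zero_closed by simp
    ultimately show "\<zero> \<in> lead I n"
      using subringE(2)[OF S] by (auto simp: lead_def)
  next
    fix s t assume "s \<in> lead I n" "t \<in> lead I n"
    then obtain p q where *: "p \<in> polys S x n" "q \<in> polys S x n" "s \<in> S" "t \<in> S"
      "p \<oplus> s \<otimes> x [^] n \<in> I" "q \<oplus> t \<otimes> x [^] n \<in> I"
      by (auto simp: lead_def)
    then have c: "p \<in> carrier R" "q \<in> carrier R" "s \<in> carrier R" "t \<in> carrier R" "x [^] n \<in> carrier R"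
      using polys_carrier S_carrier x by auto
    have "(p \<oplus> q) \<oplus> (s \<oplus> t) \<otimes> x [^] n = (p \<oplus> s \<otimes> x [^] n) \<oplus> (q \<oplus> t \<otimes> x [^] n)"
      using c by algebra
    then have "(p \<oplus> q) \<oplus> (s \<oplus> t) \<otimes> x [^] n \<in> I"
      using I.a_closed[OF *(5,6)] by simp
    then show "s \<oplus> t \<in> lead I n"
      unfolding lead_def using polys_add[OF *(1,2)] subringE(7)[OF S *(3,4)] by blast
  next
    fix r s assume r: "r \<in> S" and "s \<in> lead I n"
    then obtain p where *: "p \<in> polys S x n" "s \<in> S" "p \<oplus> s \<otimes> x [^] n \<in> I"
      by (auto simp: lead_def)
    then have c: "p \<in> carrier R" "s \<in> carrier R" "r \<in> carrier R" "x [^] n \<in> carrier R"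
      using polys_carrier S_carrier x r by auto
    have "r \<otimes> p \<oplus> (r \<otimes> s) \<otimes> x [^] n = r \<otimes> (p \<oplus> s \<otimes> x [^] n)"
      using c by algebra
    then have "r \<otimes> p \<oplus> (r \<otimes> s) \<otimes> x [^] n \<in> I"
      using I.I_l_closed[OF *(3) c(3)] by simp
    then show "r \<otimes> s \<in> lead I n"
      unfolding lead_def using polys_smult[OF r *(1)] subringE(6)[OF S r *(2)] by blast
  qed
qed

lemma lead_step:
  assumes I: "ideal I R"
  shows "lead I n \<subseteq> lead I (Suc n)"
proof
  fix s assume "s \<in> lead I n"
  then obtain p where *: "p \<in> polys S x n" "s \<in> S" "p \<oplus> s \<otimes> x [^] n \<in> I"
    by (auto simp: lead_def)
  then have c: "p \<in> carrier R" "s \<in> carrier R" "x [^] n \<in> carrier R"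
    using polys_carrier S_carrier x by auto
  have "x \<otimes> p \<oplus> s \<otimes> (x [^] n \<otimes> x) = x \<otimes> (p \<oplus> s \<otimes> x [^] n)"
    using c x by algebra
  then have "x \<otimes> p \<oplus> s \<otimes> x [^] Suc n \<in> I"
    using ideal.I_l_closed[OF I *(3) x] by simp
  then show "s \<in> lead I (Suc n)"
    unfolding lead_def using polys_shift[OF *(1)] *(2) by blast
qed

lemma lead_mono: "I \<subseteq> J \<Longrightarrow> lead I n \<subseteq> lead J n"
  by (auto simp: lead_def)

text \<open>
  Induction on the degree: given an element of \<open>J\<close> of degree at most \<open>n\<close>, there is an
  element of \<open>I\<close> with the same coefficient of \<open>x [^] n\<close>, and the difference of the two lies in
  \<open>J\<close> and has smaller degree.
\<close>

lemma ideal_eq_if_lead_eq: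
  assumes I: "ideal I R" and J: "ideal J R" and "I \<subseteq> J" and "\<And>n. lead J n \<subseteq> lead I n"
    and gen: "generate_ring R (insert x S) = carrier R"
  shows "I = J"
proof
  interpret I: ideal I R by fact
  interpret J: ideal J R by fact
  have "p \<in> I" if "p \<in> polys S x n" "p \<in> J" for p n
    using that
  proof (induction n arbitrary: p)
    case 0
    then show ?case by (simp add: polys_0 I.zero_closed)
  next
    case (Suc n)
    then obtain p' s where *: "p = p' \<oplus> s \<otimes> x [^] n" "p' \<in> polys S x n" "s \<in> S"
      by (auto simp: polys_Suc)
    then have "s \<in> lead J n" using Suc.prems by (auto simp: lead_def)
    then obtain q where q: "q \<in> polys S x n" "q \<oplus> s \<otimes> x [^] n \<in> I"
      using assms(4) by (auto simp: lead_def)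
    have c: "p' \<in> carrier R" "q \<in> carrier R" "s \<in> carrier R" "x [^] n \<in> carrier R"
      using polys_carrier S_carrier x * q by auto
    have m: "\<ominus> \<one> \<in> S" using subringE(3,5)[OF S] by blast
    have "p' \<ominus> q = p \<ominus> (q \<oplus> s \<otimes> x [^] n)"
      unfolding * using c by algebra
    moreover have "\<dots> \<in> J"
      using Suc.prems(2) q(2) \<open>I \<subseteq> J\<close> by (auto simp: a_minus_def intro: J.a_closed J.a_inv_closed)
    moreover have "p' \<ominus> q \<in> polys S x n"
    proof -
      have "p' \<oplus> (\<ominus> \<one>) \<otimes> q \<in> polys S x n"
        using polys_add[OF *(2) polys_smult[OF m q(1)]] .
      moreover have "p' \<oplus> (\<ominus> \<one>) \<otimes> q = p' \<ominus> q" using c by algebra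
      ultimately show ?thesis by simp
    qed
    ultimately have "p' \<ominus> q \<in> I" using Suc.IH by simp
    then have "(p' \<ominus> q) \<oplus> (q \<oplus> s \<otimes> x [^] n) \<in> I" using q(2) I.a_closed by blast
    moreover have "(p' \<ominus> q) \<oplus> (q \<oplus> s \<otimes> x [^] n) = p" unfolding * using c by algebra
    ultimately show ?case by simp
  qed
  moreover have "\<exists>n. p \<in> polys S x n" if "p \<in> J" for p
    using generate_ring_polys gen J.a_subset that by blast
  ultimately show "J \<subseteq> I" by blast
qed fact

text \<open>
  The ideals \<open>lead (I n) k\<close> of \<open>S\<close> increase with \<open>n\<close> and with \<open>k\<close>.  The diagonal \<open>n = k\<close>
  becomes constant at some \<open>N\<close>, which by monotonicity settles all degrees \<open>k \<ge> N\<close> at the same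
  time.  The finitely many degrees below \<open>N\<close> become constant one by one.  Past the largest of
  these indices, consecutive ideals \<open>I n\<close> have the same coefficient ideals and so are equal.
\<close>

lemma Hilbert_basis:
  assumes noeth: "noetherian_ring (R\<lparr>carrier := S\<rparr>)"
    and gen: "generate_ring R (insert x S) = carrier R"
  shows "noetherian_ring R"
proof (rule noetherian_if_ascending_ideals_stabilize)
  fix I :: "nat \<Rightarrow> 'a set"
  assume I: "\<And>n. ideal (I n) R" and mono: "\<And>n. I n \<subseteq> I (Suc n)"
  interpret Q: noetherian_ring "R\<lparr>carrier := S\<rparr>" by fact
  have I_le: "I m \<subseteq> I n" if "m \<le> n" for m n
    using lift_Suc_mono_le[of I, OF mono that] .
  have lead_le: "lead (I m) k \<subseteq> lead (I n) l" if "m \<le> n" "k \<le> l" for m n k l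
    using lift_Suc_mono_le[of "lead (I m)", OF lead_step[OF I] that(2)] lead_mono[OF I_le[OF that(1)]]
    by blast
  obtain N where N: "\<And>n. n \<ge> N \<Longrightarrow> lead (I n) n = lead (I N) N"
    using Q.ascending_ideals_stabilize[of "\<lambda>n. lead (I n) n"] lead_ideal I lead_le[of _ "Suc _" _ "Suc _"]
    by (metis le_SucI order_refl)
  have "\<forall>k. \<exists>M. \<forall>n \<ge> M. lead (I n) k = lead (I M) k"
    using Q.ascending_ideals_stabilize[of "\<lambda>n. lead (I n) _"] lead_ideal I lead_le
    by (meson le_SucI order_refl)
  then obtain M where M: "\<And>k n. n \<ge> M k \<Longrightarrow> lead (I n) k = lead (I (M k)) k"
    by metis
  define B where "B = Max (insert N (M ` {..<N}))"
  have BN: "B \<ge> N" and BM: "k < N \<Longrightarrow> B \<ge> M k" for k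
    by (auto simp: B_def)
  have "I B = I (Suc B)"
  proof (rule ideal_eq_if_lead_eq[OF I I mono _ gen])
    fix k
    show "lead (I (Suc B)) k \<subseteq> lead (I B) k"
    proof (cases "k < N")
      case True
      then show ?thesis using M[of k B] M[of k "Suc B"] BM by (metis le_SucI order_refl)
    next
      case False
      then have "lead (I (Suc B)) k \<subseteq> lead (I (max (Suc B) k)) (max (Suc B) k)"
        by (intro lead_le) auto
      also have "\<dots> = lead (I N) N" using BN by (intro N) auto
      also have "\<dots> \<subseteq> lead (I B) k" using BN False by (intro lead_le) auto
      finally show ?thesis .
    qed
  qed
  then show "\<exists>N. I (Suc N) = I N" by metis
qed

end

end

text \<open>
  The kernels of the iterates of \<open>h\<close> ascend, so \<open>h ^^ N\<close> and \<open>h ^^ Suc N\<close> have the same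
  kernel for some \<open>N\<close>.  An element \<open>a\<close> of the kernel of \<open>h\<close> has the form \<open>(h ^^ N) r\<close>; then
  \<open>r\<close> is in the kernel of \<open>h ^^ Suc N\<close>, hence in that of \<open>h ^^ N\<close>, and \<open>a\<close> is zero.
\<close>

lemma (in noetherian_ring) surjective_endomorphism_inj:
  assumes h: "h \<in> ring_hom R R" and surj: "h ` carrier R = carrier R"
  shows "inj_on h (carrier R)"
proof -
  interpret h: ring_hom_ring R R h
    using h by (intro ring_hom_ringI2 ring_axioms)
  have pow: "(h ^^ n) \<in> ring_hom R R" for n
    by (induction n) (auto simp: ring_hom_def Pi_def)
  have surj_pow: "(h ^^ n) ` carrier R = carrier R" for n
  proof (induction n)
    case (Suc n)
    have "(h ^^ Suc n) ` carrier R = h ` (h ^^ n) ` carrier R" by (simp add: image_image)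
    then show ?case using Suc surj by simp
  qed simp
  define I where "I n = a_kernel R R (h ^^ n)" for n
  have I_iff: "r \<in> I n \<longleftrightarrow> r \<in> carrier R \<and> (h ^^ n) r = \<zero>" for r n
    by (auto simp: I_def a_kernel_def')
  have "ideal (I n) R" for n
    unfolding I_def
    using ring_hom_ring.kernel_is_ideal[OF ring_hom_ringI2[OF ring_axioms ring_axioms pow]] .
  moreover have "I n \<subseteq> I (Suc n)" for n
    by (auto simp: I_iff)
  ultimately obtain N where N: "I (Suc N) = I N"
    using ascending_ideals_stabilize[of I] by (meson le_SucI order_refl)
  have ker: "a = \<zero>" if a: "a \<in> carrier R" "h a = \<zero>" for a
  proof -
    obtain r where r: "r \<in> carrier R" "a = (h ^^ N) r"
      using a(1) surj_pow[of N] by (metis imageE)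
    then have "r \<in> I (Suc N)" using a(2) by (simp add: I_iff)
    then show ?thesis using N r by (auto simp: I_iff)
  qed
  have "a_kernel R R h = {\<zero>}"
  proof
    show "a_kernel R R h \<subseteq> {\<zero>}" using ker unfolding a_kernel_def' by blast
    show "{\<zero>} \<subseteq> a_kernel R R h" using h.hom_zero unfolding a_kernel_def' by blast
  qed
  then show ?thesis
    by (rule h.trivial_ker_imp_inj)
qed

lemma (in cring) noetherian_generate_ring:
  assumes L: "subring L R" "noetherian_ring (R\<lparr>carrier := L\<rparr>)"
    and T: "finite T" "T \<subseteq> carrier R"
  shows "noetherian_ring (R\<lparr>carrier := generate_ring R (L \<union> T)\<rparr>)"
  using T
proof (induction T)
  case empty
  have "generate_ring R L = L"
    using generate_ringI[OF subringE(1)[OF L(1)] L(1)] by simp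
  then show ?case using L(2) by simp
next
  case (insert x T)
  define S where "S = generate_ring R (L \<union> T)"
  define Q where "Q = generate_ring R (insert x (L \<union> T))"
  have sub: "insert x (L \<union> T) \<subseteq> carrier R"
    using insert.prems subringE(1)[OF L(1)] by blast
  have S: "subring S R" and Q: "subring Q R"
    unfolding S_def Q_def using generate_ring_is_subring sub by simp_all
  have SQ: "S \<subseteq> Q" unfolding S_def Q_def by (rule mono_generate_ring) (use sub in auto)
  have LTS: "L \<union> T \<subseteq> S" unfolding S_def by (auto intro: generate_ring.incl)
  have xQ: "x \<in> Q" unfolding Q_def by (rule generate_ring.incl) simp
  interpret Q: cring "R\<lparr>carrier := Q\<rparr>"
    using subcringI'[OF Q] unfolding subcring_iff[OF subringE(1)[OF Q]] .
  have "noetherian_ring (R\<lparr>carrier := Q\<rparr>)"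
  proof (rule Q.Hilbert_basis)
    show "subring S (R\<lparr>carrier := Q\<rparr>)"
      using Q.ring_incl_imp_subring[of S] subring_is_ring[OF S] SQ by simp
    show "x \<in> carrier (R\<lparr>carrier := Q\<rparr>)" using xQ by simp
    show "noetherian_ring ((R\<lparr>carrier := Q\<rparr>)\<lparr>carrier := S\<rparr>)"
      using insert.IH insert.prems by (simp add: S_def)
    have "generate_ring R (insert x S) = Q"
    proof
      show "generate_ring R (insert x S) \<subseteq> Q"
        by (rule generate_ring_min_subring1[OF _ Q]) (use SQ xQ subringE(1)[OF Q] in auto)
      show "Q \<subseteq> generate_ring R (insert x S)"
        unfolding Q_def by (rule mono_generate_ring) (use LTS sub subringE(1)[OF S] in auto)
    qed
    then show "generate_ring (R\<lparr>carrier := Q\<rparr>) (insert x S) = carrier (R\<lparr>carrier := Q\<rparr>)"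
      using subring_gen_equality[OF Q, of "insert x S"] SQ xQ by simp
  qed
  then show ?case by (simp add: Q_def)
qed

text \<open>
  The image of a field has no ideals besides zero and itself: a nonzero element of an ideal comes
  from an invertible scalar.
\<close>

lemma (in algebra) subfield_image_noetherian:
  assumes "field R"
  shows "subring ((\<lambda>k. k \<odot>\<^bsub>M\<^esub> \<one>\<^bsub>M\<^esub>) ` carrier R) M"
    and "noetherian_ring (M\<lparr>carrier := (\<lambda>k. k \<odot>\<^bsub>M\<^esub> \<one>\<^bsub>M\<^esub>) ` carrier R\<rparr>)"
proof -
  let ?\<iota> = "\<lambda>k. k \<odot>\<^bsub>M\<^esub> \<one>\<^bsub>M\<^esub>"
  interpret R: field R by fact
  have Mr: "ring M" using M_cring cring.axioms(1) by blast
  have mult: "?\<iota> k \<otimes>\<^bsub>M\<^esub> ?\<iota> l = ?\<iota> (k \<otimes> l)" if "k \<in> carrier R" "l \<in> carrier R" for k l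
    using that smult_assoc2[of k "\<one>\<^bsub>M\<^esub>" "?\<iota> l"] by (simp add: smult_assoc1)
  show sub: "subring (?\<iota> ` carrier R) M"
  proof (rule ring.subringI[OF Mr])
    show "\<one>\<^bsub>M\<^esub> \<in> ?\<iota> ` carrier R" by (intro image_eqI[of _ _ \<one>]) auto
    fix a b assume "a \<in> ?\<iota> ` carrier R" "b \<in> ?\<iota> ` carrier R"
    then obtain k l where kl: "k \<in> carrier R" "l \<in> carrier R" "a = ?\<iota> k" "b = ?\<iota> l" by blast
    show "\<ominus>\<^bsub>M\<^esub> a \<in> ?\<iota> ` carrier R"
      using kl by (intro image_eqI[of _ _ "\<ominus> k"]) (auto simp: smult_l_minus)
    show "a \<otimes>\<^bsub>M\<^esub> b \<in> ?\<iota> ` carrier R"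
      using kl mult by (intro image_eqI[of _ _ "k \<otimes> l"]) auto
    show "a \<oplus>\<^bsub>M\<^esub> b \<in> ?\<iota> ` carrier R"
      using kl by (intro image_eqI[of _ _ "k \<oplus> l"]) (auto simp: smult_l_distr)
  qed auto
  interpret Q: ring "M\<lparr>carrier := ?\<iota> ` carrier R\<rparr>"
    using ring.subring_is_ring[OF Mr sub] .
  have alt: "J = {\<zero>\<^bsub>M\<^esub>} \<or> J = ?\<iota> ` carrier R" if J: "ideal J (M\<lparr>carrier := ?\<iota> ` carrier R\<rparr>)" for J
  proof -
    interpret J: ideal J "M\<lparr>carrier := ?\<iota> ` carrier R\<rparr>" by fact
    have zero: "\<zero>\<^bsub>M\<^esub> \<in> J" using J.zero_closed by simp
    show ?thesis
    proof (cases "J = {\<zero>\<^bsub>M\<^esub>}")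
      case False
      then obtain a where a: "a \<in> J" "a \<noteq> \<zero>\<^bsub>M\<^esub>" using zero by blast
      then obtain k where k: "k \<in> carrier R" "a = ?\<iota> k" using J.a_subset by auto
      then have "k \<noteq> \<zero>" using a by auto
      then have "inv k \<in> carrier R" "inv k \<otimes> k = \<one>"
        using k R.field_Units R.Units_l_inv R.Units_inv_closed by auto
      then have "\<one>\<^bsub>M\<^esub> \<in> J"
        using J.I_l_closed[OF a(1), of "?\<iota> (inv k)"] mult[of "inv k" k] k by simp
      then show ?thesis using J.one_imp_carrier by simp
    qed simp
  qed
  show "noetherian_ring (M\<lparr>carrier := ?\<iota> ` carrier R\<rparr>)"
  proof (rule Q.noetherian_if_ascending_ideals_stabilize)
    fix I :: "nat \<Rightarrow> _" assume "\<And>n. ideal (I n) (M\<lparr>carrier := ?\<iota> ` carrier R\<rparr>)" "\<And>n. I n \<subseteq> I (Suc n)"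
    then have "I n = {\<zero>\<^bsub>M\<^esub>} \<or> I n = ?\<iota> ` carrier R" "I n \<subseteq> I (Suc n)" for n using alt by blast+
    \<comment> \<open>An ascending sequence of zero ideals and whole rings jumps at most once.\<close>
    from this[of 0] this[of 1] this[of 2] have "I (Suc 0) = I 0 \<or> I (Suc 1) = I 1"
      using sub subringE(2) by (auto simp: numeral_2_eq_2)
    then show "\<exists>N. I (Suc N) = I N" by blast
  qed
qed

lemma (in algebra) finitely_generated_noetherian:
  assumes R: "field R" and fg: "finitely_generated_algebra R M"
  shows "noetherian_ring M"
proof -
  obtain T where T: "finite T" "T \<subseteq> carrier M"
    "generate_ring M ((\<lambda>k. k \<odot>\<^bsub>M\<^esub> \<one>\<^bsub>M\<^esub>) ` carrier R \<union> T) = carrier M"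
    using fg unfolding finitely_generated_algebra_def by blast
  then show ?thesis
    using cring.noetherian_generate_ring[OF M_cring subfield_image_noetherian[OF R] T(1,2)]
    by simp
qed

section \<open>Poisson algebras and their homomorphisms\<close>

context poisson_algebra
begin

declare bracket_closed [simp, intro]

lemma mult_smult_right:
  assumes "k \<in> carrier K" "a \<in> carrier A" "b \<in> carrier A"
  shows "a \<otimes>\<^bsub>A\<^esub> (k \<odot>\<^bsub>A\<^esub> b) = k \<odot>\<^bsub>A\<^esub> (a \<otimes>\<^bsub>A\<^esub> b)"
  using assms smult_assoc2[of k b a] by (simp add: m_comm)

text \<open>
  The Leibniz rule for \<open>1 = 1 \<cdot> 1\<close> says that this bracket is twice itself.
\<close>

lemma bracket_one_right:
  assumes a: "a \<in> carrier A"
  shows "\<lbrace>a, \<one>\<^bsub>A\<^esub>\<rbrace>\<^bsub>A\<^esub> = \<zero>\<^bsub>A\<^esub>"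
proof -
  have "\<lbrace>a, \<one>\<^bsub>A\<^esub>\<rbrace>\<^bsub>A\<^esub> = \<lbrace>a, \<one>\<^bsub>A\<^esub>\<rbrace>\<^bsub>A\<^esub> \<oplus>\<^bsub>A\<^esub> \<lbrace>a, \<one>\<^bsub>A\<^esub>\<rbrace>\<^bsub>A\<^esub>"
    using bracket_leibniz[OF a one_closed one_closed] bracket_closed[OF a one_closed] by simp
  then show ?thesis
    using bracket_closed[OF a one_closed] by (metis add.l_cancel_one)
qed

lemma bracket_antisym:
  assumes a: "a \<in> carrier A" and b: "b \<in> carrier A"
  shows "\<lbrace>b, a\<rbrace>\<^bsub>A\<^esub> = \<ominus>\<^bsub>A\<^esub> \<lbrace>a, b\<rbrace>\<^bsub>A\<^esub>"
proof -
  have "\<lbrace>a \<oplus>\<^bsub>A\<^esub> b, a \<oplus>\<^bsub>A\<^esub> b\<rbrace>\<^bsub>A\<^esub> = \<lbrace>a, a \<oplus>\<^bsub>A\<^esub> b\<rbrace>\<^bsub>A\<^esub> \<oplus>\<^bsub>A\<^esub> \<lbrace>b, a \<oplus>\<^bsub>A\<^esub> b\<rbrace>\<^bsub>A\<^esub>"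
    using a b by (intro bracket_add_left) auto
  also have "\<dots> = \<lbrace>a, b\<rbrace>\<^bsub>A\<^esub> \<oplus>\<^bsub>A\<^esub> \<lbrace>b, a\<rbrace>\<^bsub>A\<^esub>"
    using a b by (simp add: bracket_add_right bracket_self)
  finally have "\<lbrace>a \<oplus>\<^bsub>A\<^esub> b, a \<oplus>\<^bsub>A\<^esub> b\<rbrace>\<^bsub>A\<^esub> = \<lbrace>a, b\<rbrace>\<^bsub>A\<^esub> \<oplus>\<^bsub>A\<^esub> \<lbrace>b, a\<rbrace>\<^bsub>A\<^esub>" .
  then have "\<lbrace>b, a\<rbrace>\<^bsub>A\<^esub> \<oplus>\<^bsub>A\<^esub> \<lbrace>a, b\<rbrace>\<^bsub>A\<^esub> = \<zero>\<^bsub>A\<^esub>"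
    using a b bracket_self[of "a \<oplus>\<^bsub>A\<^esub> b"] by (simp add: a_comm)
  then show ?thesis using minus_equality[of "\<lbrace>b, a\<rbrace>\<^bsub>A\<^esub>" "\<lbrace>a, b\<rbrace>\<^bsub>A\<^esub>"] a b by simp
qed

lemma bracket_one_left:
  assumes a: "a \<in> carrier A"
  shows "\<lbrace>\<one>\<^bsub>A\<^esub>, a\<rbrace>\<^bsub>A\<^esub> = \<zero>\<^bsub>A\<^esub>"
  using bracket_antisym[OF a one_closed] bracket_one_right[OF a] by simp

end

text \<open>
  The axioms that let an identity between brackets or products be checked on additive generators.
  They hold in Poisson algebras and in their tensor products, so that homomorphisms between
  algebras of both kinds can be treated together.
\<close>

locale biadditive_algebra = M?: abelian_group M for K :: "('k, 'n) ring_scheme" and M :: "('k, 'a, 'm) poisson_scheme" +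
  assumes mult_closed [simp, intro]: "\<lbrakk>x \<in> carrier M; y \<in> carrier M\<rbrakk> \<Longrightarrow> x \<otimes>\<^bsub>M\<^esub> y \<in> carrier M"
    and mult_add_left: "\<lbrakk>x \<in> carrier M; y \<in> carrier M; z \<in> carrier M\<rbrakk>
      \<Longrightarrow> (x \<oplus>\<^bsub>M\<^esub> y) \<otimes>\<^bsub>M\<^esub> z = x \<otimes>\<^bsub>M\<^esub> z \<oplus>\<^bsub>M\<^esub> y \<otimes>\<^bsub>M\<^esub> z"
    and mult_add_right: "\<lbrakk>x \<in> carrier M; y \<in> carrier M; z \<in> carrier M\<rbrakk>
      \<Longrightarrow> x \<otimes>\<^bsub>M\<^esub> (y \<oplus>\<^bsub>M\<^esub> z) = x \<otimes>\<^bsub>M\<^esub> y \<oplus>\<^bsub>M\<^esub> x \<otimes>\<^bsub>M\<^esub> z"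
    and lie_closed [simp, intro]: "\<lbrakk>x \<in> carrier M; y \<in> carrier M\<rbrakk> \<Longrightarrow> \<lbrace>x, y\<rbrace>\<^bsub>M\<^esub> \<in> carrier M"
    and lie_add_left: "\<lbrakk>x \<in> carrier M; y \<in> carrier M; z \<in> carrier M\<rbrakk>
      \<Longrightarrow> \<lbrace>x \<oplus>\<^bsub>M\<^esub> y, z\<rbrace>\<^bsub>M\<^esub> = \<lbrace>x, z\<rbrace>\<^bsub>M\<^esub> \<oplus>\<^bsub>M\<^esub> \<lbrace>y, z\<rbrace>\<^bsub>M\<^esub>"
    and lie_add_right: "\<lbrakk>x \<in> carrier M; y \<in> carrier M; z \<in> carrier M\<rbrakk>
      \<Longrightarrow> \<lbrace>x, y \<oplus>\<^bsub>M\<^esub> z\<rbrace>\<^bsub>M\<^esub> = \<lbrace>x, y\<rbrace>\<^bsub>M\<^esub> \<oplus>\<^bsub>M\<^esub> \<lbrace>x, z\<rbrace>\<^bsub>M\<^esub>"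
    and scale_closed [simp, intro]: "\<lbrakk>k \<in> carrier K; x \<in> carrier M\<rbrakk> \<Longrightarrow> k \<odot>\<^bsub>M\<^esub> x \<in> carrier M"
    and scale_add: "\<lbrakk>k \<in> carrier K; x \<in> carrier M; y \<in> carrier M\<rbrakk>
      \<Longrightarrow> k \<odot>\<^bsub>M\<^esub> (x \<oplus>\<^bsub>M\<^esub> y) = k \<odot>\<^bsub>M\<^esub> x \<oplus>\<^bsub>M\<^esub> k \<odot>\<^bsub>M\<^esub> y"

lemma (in poisson_algebra) biadditive: "biadditive_algebra K A"
proof -
  show ?thesis
    by unfold_locales (auto simp: l_distr r_distr bracket_add_left bracket_add_right smult_r_distr)
qed

definition poisson_hom ::
    "('k, 'n) ring_scheme \<Rightarrow> ('k, 'a, 'm) poisson_scheme \<Rightarrow> ('k, 'b, 'l) poisson_scheme \<Rightarrow> ('a \<Rightarrow> 'b) set"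
  where "poisson_hom K A B = {h \<in> ring_hom A B.
    (\<forall>k \<in> carrier K. \<forall>a \<in> carrier A. h (k \<odot>\<^bsub>A\<^esub> a) = k \<odot>\<^bsub>B\<^esub> h a) \<and>
    (\<forall>a \<in> carrier A. \<forall>b \<in> carrier A. h \<lbrace>a, b\<rbrace>\<^bsub>A\<^esub> = \<lbrace>h a, h b\<rbrace>\<^bsub>B\<^esub>)}"

lemma poisson_homD:
  assumes "h \<in> poisson_hom K A B"
  shows "a \<in> carrier A \<Longrightarrow> h a \<in> carrier B"
    and "\<lbrakk>a \<in> carrier A; b \<in> carrier A\<rbrakk> \<Longrightarrow> h (a \<otimes>\<^bsub>A\<^esub> b) = h a \<otimes>\<^bsub>B\<^esub> h b"
    and "\<lbrakk>a \<in> carrier A; b \<in> carrier A\<rbrakk> \<Longrightarrow> h (a \<oplus>\<^bsub>A\<^esub> b) = h a \<oplus>\<^bsub>B\<^esub> h b"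
    and "h \<one>\<^bsub>A\<^esub> = \<one>\<^bsub>B\<^esub>"
    and "\<lbrakk>k \<in> carrier K; a \<in> carrier A\<rbrakk> \<Longrightarrow> h (k \<odot>\<^bsub>A\<^esub> a) = k \<odot>\<^bsub>B\<^esub> h a"
    and "\<lbrakk>a \<in> carrier A; b \<in> carrier A\<rbrakk> \<Longrightarrow> h \<lbrace>a, b\<rbrace>\<^bsub>A\<^esub> = \<lbrace>h a, h b\<rbrace>\<^bsub>B\<^esub>"
  using assms by (auto simp: poisson_hom_def ring_hom_def)

lemma poisson_iso_iff:
  "h \<in> poisson_iso K A B \<longleftrightarrow> h \<in> poisson_hom K A B \<and> bij_betw h (carrier A) (carrier B)"
  by (auto simp: poisson_iso_def poisson_hom_def ring_iso_def)

lemma poisson_hom_compose: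
  assumes "g \<in> poisson_hom K B C" "h \<in> poisson_hom K A B"
  shows "(\<lambda>a. g (h a)) \<in> poisson_hom K A C"
  unfolding poisson_hom_def ring_hom_def
  by (auto simp: poisson_homD[OF assms(1)] poisson_homD[OF assms(2)])

lemma poisson_hom_inv_into:
  assumes A: "biadditive_algebra K A" and one: "\<one>\<^bsub>A\<^esub> \<in> carrier A" and h: "h \<in> poisson_iso K A B"
  shows "inv_into (carrier A) h \<in> poisson_hom K B A"
proof -
  interpret A: biadditive_algebra K A by fact
  have hom: "h \<in> poisson_hom K A B" and bij: "bij_betw h (carrier A) (carrier B)"
    using h by (auto simp: poisson_iso_iff)
  note [simp] = poisson_homD[OF hom]
  let ?g = "inv_into (carrier A) h"
  have g: "?g b \<in> carrier A" "h (?g b) = b" if "b \<in> carrier B" for b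
    using that bij by (auto simp: bij_betw_def intro: inv_into_into f_inv_into_f)
  have eq: "?g b = a" if "a \<in> carrier A" "h a = b" for a b
    using that bij by (auto simp: bij_betw_def)
  show ?thesis
    unfolding poisson_hom_def ring_hom_def
    by (auto simp: g intro!: eq one)
qed

section \<open>Free abelian groups modulo relations\<close>

text \<open>
  An operation given on the generators of a free abelian group descends to the quotient by the
  subgroup generated by \<open>E\<close> as soon as it sends the relations in \<open>E\<close> into that subgroup.  This
  is proved here for one and for two arguments, in the form in which the operations of the tensor
  product are written: as a union, over the elements of the argument cosets, of cosets that turn
  out to be all the same.
\<close>

locale frag_quotient =
  fixes S :: "'x set" and E :: "('x \<Rightarrow>\<^sub>0 int) set"
  assumes E_subset: "E \<subseteq> carrier (free_Abelian_group S)"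
begin

abbreviation "F \<equiv> free_Abelian_group S"
abbreviation "N \<equiv> generate F E"
abbreviation "cls x \<equiv> N #>\<^bsub>F\<^esub> x"

lemma N_subgroup: "subgroup N F"
  using group.generate_is_subgroup[OF group_free_Abelian_group E_subset] .

lemma N_normal: "N \<lhd> F"
  using comm_group.subgroup_imp_normal[OF abelian_free_Abelian_group N_subgroup] .

lemma N_carrier: "x \<in> N \<Longrightarrow> x \<in> carrier F"
  using subgroup.mem_carrier[OF N_subgroup] .

lemma N_zero: "0 \<in> N"
  using subgroup.one_closed[OF N_subgroup] by simp

lemma N_minus: "x \<in> N \<Longrightarrow> - x \<in> N"
  using subgroup.m_inv_closed[OF N_subgroup, of x] N_carrier[of x] by simp

lemma N_add: "\<lbrakk>x \<in> N; y \<in> N\<rbrakk> \<Longrightarrow> x + y \<in> N"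
  using subgroup.m_closed[OF N_subgroup, of x y] by simp

lemma N_diff: "\<lbrakk>x \<in> N; y \<in> N\<rbrakk> \<Longrightarrow> x - y \<in> N"
  using N_add[OF _ N_minus, of x y] by simp

lemma F_add: "\<lbrakk>x \<in> carrier F; y \<in> carrier F\<rbrakk> \<Longrightarrow> x + y \<in> carrier F"
  using keys_add[of x y] by auto

lemma F_diff: "\<lbrakk>x \<in> carrier F; y \<in> carrier F\<rbrakk> \<Longrightarrow> x - y \<in> carrier F"
  using keys_diff[of x y] by auto

lemma F_frag_extend:
  assumes "x \<in> carrier F" "\<And>p. p \<in> S \<Longrightarrow> h p \<in> carrier F"
  shows "frag_extend h x \<in> carrier F"
  using keys_frag_extend[of h x] assms by fastforce

lemma cls_eqI:
  assumes "x \<in> carrier F" "y \<in> carrier F" "x - y \<in> N"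
  shows "cls x = cls y"
proof -
  have "x \<in> cls y"
    using subgroup.rcos_module_rev[OF N_subgroup group_free_Abelian_group assms(2,1)] assms by simp
  then show ?thesis
    using group.repr_independence[OF group_free_Abelian_group _ assms(2) N_subgroup] by simp
qed

lemma cls_memD:
  assumes "x \<in> carrier F" "x' \<in> cls x"
  shows "x' \<in> carrier F" "x' - x \<in> N"
proof -
  show "x' - x \<in> N"
    using subgroup.rcos_module_imp[OF N_subgroup group_free_Abelian_group assms] assms(1) by simp
  from F_add[OF N_carrier[OF this] assms(1)] show "x' \<in> carrier F" by simp
qed

lemma cls_self: "x \<in> carrier F \<Longrightarrow> x \<in> cls x"
  using group.rcos_self[OF group_free_Abelian_group _ N_subgroup] .

lemma frag_extend_N:
  assumes "\<And>e. e \<in> E \<Longrightarrow> frag_extend h e \<in> N" and "x \<in> N"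
  shows "frag_extend h x \<in> N"
  using assms(2)
proof (induction rule: generate.induct)
  case (inv e)
  then have "Poly_Mapping.keys e \<subseteq> S" using subsetD[OF E_subset] by simp
  then show ?case
    using N_minus[OF assms(1)[OF inv]] by (simp add: frag_extend_minus)
qed (auto simp: N_zero assms(1) frag_extend_add N_add)

lemma frag_extend_cls:
  assumes carr: "\<And>p. p \<in> S \<Longrightarrow> h p \<in> carrier F"
    and rel: "\<And>e. e \<in> E \<Longrightarrow> frag_extend h e \<in> N" and x: "x \<in> carrier F"
  shows "(\<Union>x'\<in>cls x. cls (frag_extend h x')) = cls (frag_extend h x)"
proof -
  have "cls (frag_extend h x') = cls (frag_extend h x)" if "x' \<in> cls x" for x'
  proof (rule cls_eqI)
    note x' = cls_memD[OF x that]
    show "frag_extend h x' \<in> carrier F" "frag_extend h x \<in> carrier F"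
      using F_frag_extend carr x x'(1) by blast+
    show "frag_extend h x' - frag_extend h x \<in> N"
      using frag_extend_N[OF rel x'(2)] by (simp add: frag_extend_diff)
  qed
  then show ?thesis using cls_self[OF x] by blast
qed

definition bilinear_extend :: "('x \<Rightarrow> 'x \<Rightarrow> 'x \<Rightarrow>\<^sub>0 int) \<Rightarrow> ('x \<Rightarrow>\<^sub>0 int) \<Rightarrow> ('x \<Rightarrow>\<^sub>0 int) \<Rightarrow> 'x \<Rightarrow>\<^sub>0 int"
  where "bilinear_extend h x y = frag_extend (\<lambda>p. frag_extend (h p) y) x"

lemma bilinear_extend_of [simp]: "bilinear_extend h (frag_of p) (frag_of q) = h p q"
  by (simp add: bilinear_extend_def)

lemma bilinear_extend_diff_left:
  "bilinear_extend h (x - x') y = bilinear_extend h x y - bilinear_extend h x' y"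
  by (simp add: bilinear_extend_def frag_extend_diff)

lemma bilinear_extend_add_left:
  "bilinear_extend h (x + x') y = bilinear_extend h x y + bilinear_extend h x' y"
  by (simp add: bilinear_extend_def frag_extend_add)

lemma bilinear_extend_add_right:
  "bilinear_extend h x (y + y') = bilinear_extend h x y + bilinear_extend h x y'"
  unfolding bilinear_extend_def
  by (simp add: frag_extend_add) (simp add: frag_extend_def frag_cmul_distrib2 sum.distrib)

lemma bilinear_extend_diff_right:
  "bilinear_extend h x (y - y') = bilinear_extend h x y - bilinear_extend h x y'"
  using bilinear_extend_add_right[of h x "y - y'" y'] by simp

lemma bilinear_extend_carrier:
  assumes "\<And>p q. \<lbrakk>p \<in> S; q \<in> S\<rbrakk> \<Longrightarrow> h p q \<in> carrier F" "x \<in> carrier F" "y \<in> carrier F"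
  shows "bilinear_extend h x y \<in> carrier F"
  unfolding bilinear_extend_def using assms by (intro F_frag_extend)

text \<open>
  Passing from \<open>(x, y)\<close> to other representatives \<open>(x', y')\<close> changes the value \<open>h x y\<close> by
  \<open>h (x' - x) y' + h x (y' - y)\<close>.  Both summands lie in \<open>N\<close>: by additivity it is enough to pair a
  relation with a generator.
\<close>

lemma bilinear_extend_cls:
  assumes carr: "\<And>p q. \<lbrakk>p \<in> S; q \<in> S\<rbrakk> \<Longrightarrow> h p q \<in> carrier F"
    and left: "\<And>e q. \<lbrakk>e \<in> E; q \<in> S\<rbrakk> \<Longrightarrow> bilinear_extend h e (frag_of q) \<in> N"
    and right: "\<And>p e. \<lbrakk>p \<in> S; e \<in> E\<rbrakk> \<Longrightarrow> bilinear_extend h (frag_of p) e \<in> N"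
    and x: "x \<in> carrier F" and y: "y \<in> carrier F"
  shows "(\<Union>x'\<in>cls x. \<Union>y'\<in>cls y. cls (bilinear_extend h x' y')) = cls (bilinear_extend h x y)"
proof -
  have N_left: "bilinear_extend h n z \<in> N" if n: "n \<in> N" and z: "z \<in> carrier F" for n z
  proof -
    from z have "Poly_Mapping.keys z \<subseteq> S" by simp
    then show ?thesis
    proof (induction rule: free_Abelian_group_induct[consumes 1, case_names zero diff of])
      case zero
      then show ?case using bilinear_extend_diff_right[of h n 0 0] N_zero by simp
    next
      case (diff z z')
      then show ?case by (simp add: bilinear_extend_diff_right N_diff)
    next
      case (of q)
      show ?case
        using frag_extend_N[OF left[unfolded bilinear_extend_def, OF _ of] n]
        by (simp add: bilinear_extend_def)
    qed
  qed
  have N_right: "bilinear_extend h z n \<in> N" if n: "n \<in> N" and z: "z \<in> carrier F" for n z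
  proof -
    from z have "Poly_Mapping.keys z \<subseteq> S" by simp
    then show ?thesis
    proof (induction rule: free_Abelian_group_induct[consumes 1, case_names zero diff of])
      case zero
      then show ?case using bilinear_extend_diff_left[of h 0 0 n] N_zero by simp
    next
      case (diff z z')
      then show ?case by (simp add: bilinear_extend_diff_left N_diff)
    next
      case (of p)
      have "frag_extend (h p) n \<in> N"
        using right[OF of] by (intro frag_extend_N[OF _ n]) (simp add: bilinear_extend_def)
      then show ?case by (simp add: bilinear_extend_def)
    qed
  qed
  have "cls (bilinear_extend h x' y') = cls (bilinear_extend h x y)" if "x' \<in> cls x" "y' \<in> cls y" for x' y'
  proof (rule cls_eqI)
    note x' = cls_memD[OF x that(1)] and y' = cls_memD[OF y that(2)]
    show "bilinear_extend h x' y' \<in> carrier F" "bilinear_extend h x y \<in> carrier F"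
      using bilinear_extend_carrier carr x y x'(1) y'(1) by blast+
    have "bilinear_extend h x' y' - bilinear_extend h x y =
        bilinear_extend h (x' - x) y' + bilinear_extend h x (y' - y)"
      by (simp add: bilinear_extend_diff_left bilinear_extend_diff_right)
    then show "bilinear_extend h x' y' - bilinear_extend h x y \<in> N"
      using N_add[OF N_left[OF x'(2) y'(1)] N_right[OF y'(2) x]] by simp
  qed
  then show ?thesis using cls_self[OF x] cls_self[OF y] by blast
qed

end

section \<open>Tensor products of Poisson algebras\<close>

locale poisson_pair = A: poisson_algebra K A + R: poisson_algebra K R
  for K :: "('k, 'n) ring_scheme" and A :: "('k, 'a, 'm) poisson_scheme"
    and R :: "('k, 'r, 'l) poisson_scheme"
begin

abbreviation "pairs \<equiv> carrier A \<times> carrier R"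

sublocale Q: frag_quotient pairs "tensor_relations K A R"
proof
  have diff: "x - y \<in> carrier (free_Abelian_group pairs)"
    if "x \<in> carrier (free_Abelian_group pairs)" "y \<in> carrier (free_Abelian_group pairs)" for x y
    using keys_diff[of x y] that by auto
  show "tensor_relations K A R \<subseteq> carrier (free_Abelian_group pairs)"
    unfolding tensor_relations_def
    by (intro Un_least subsetI; clarify; intro diff; simp)
qed

abbreviation "T \<equiv> poisson_tensor K A R"

definition tens :: "'a \<Rightarrow> 'r \<Rightarrow> ('a \<times> 'r \<Rightarrow>\<^sub>0 int) set"
  where "tens a r = Q.cls (frag_of (a, r))"

lemma T_carrier: "carrier T = Q.cls ` carrier Q.F"
  by (simp add: poisson_tensor_def Let_def carrier_FactGroup)

lemma T_zero: "\<zero>\<^bsub>T\<^esub> = Q.cls 0"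
  using group.coset_join2[OF group_free_Abelian_group _ Q.N_subgroup Q.N_zero]
  by (simp add: poisson_tensor_def Let_def)

lemma T_one: "\<one>\<^bsub>T\<^esub> = tens \<one>\<^bsub>A\<^esub> \<one>\<^bsub>R\<^esub>"
  by (simp add: poisson_tensor_def Let_def tens_def)

lemma T_add: "\<lbrakk>x \<in> carrier Q.F; y \<in> carrier Q.F\<rbrakk> \<Longrightarrow> Q.cls x \<oplus>\<^bsub>T\<^esub> Q.cls y = Q.cls (x + y)"
  using normal.rcos_sum[OF Q.N_normal, of x y] by (simp add: poisson_tensor_def Let_def)

lemma T_abelian_group: "abelian_group T"
proof (rule abelian_groupI)
  show "\<exists>Y\<in>carrier T. Y \<oplus>\<^bsub>T\<^esub> X = \<zero>\<^bsub>T\<^esub>" if "X \<in> carrier T" for X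
  proof -
    obtain x where x: "x \<in> carrier Q.F" "X = Q.cls x" using \<open>X \<in> carrier T\<close> unfolding T_carrier by blast
    then show ?thesis
      unfolding T_carrier T_zero using T_add[of "- x" x] by (intro bexI[of _ "Q.cls (- x)"]) auto
  qed
  have zero: "0 \<in> carrier Q.F" by simp
  then show "\<zero>\<^bsub>T\<^esub> \<in> carrier T" unfolding T_carrier T_zero by (rule imageI)
  show "\<zero>\<^bsub>T\<^esub> \<oplus>\<^bsub>T\<^esub> X = X" if "X \<in> carrier T" for X
    using that T_add[OF zero] unfolding T_carrier T_zero by auto
qed (auto simp: T_carrier T_add Q.F_add add_ac simp del: carrier_free_Abelian_group_iff)

sublocale T: abelian_group T by (rule T_abelian_group)

lemma rel_add_left:
  "\<lbrakk>a \<in> carrier A; b \<in> carrier A; r \<in> carrier R\<rbrakk>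
    \<Longrightarrow> frag_of (a \<oplus>\<^bsub>A\<^esub> b, r) - frag_of (a, r) - frag_of (b, r) \<in> Q.N"
  by (rule generate.incl) (auto simp: tensor_relations_def)

lemma rel_add_right:
  "\<lbrakk>a \<in> carrier A; r \<in> carrier R; s \<in> carrier R\<rbrakk>
    \<Longrightarrow> frag_of (a, r \<oplus>\<^bsub>R\<^esub> s) - frag_of (a, r) - frag_of (a, s) \<in> Q.N"
  by (rule generate.incl) (auto simp: tensor_relations_def)

lemma rel_smult:
  "\<lbrakk>k \<in> carrier K; a \<in> carrier A; r \<in> carrier R\<rbrakk>
    \<Longrightarrow> frag_of (k \<odot>\<^bsub>A\<^esub> a, r) - frag_of (a, k \<odot>\<^bsub>R\<^esub> r) \<in> Q.N"
  by (rule generate.incl) (auto simp: tensor_relations_def)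

lemma tensor_relations_cases:
  assumes "e \<in> tensor_relations K A R"
  obtains (left) a b r where "e = frag_of (a \<oplus>\<^bsub>A\<^esub> b, r) - frag_of (a, r) - frag_of (b, r)"
      "a \<in> carrier A" "b \<in> carrier A" "r \<in> carrier R"
    | (right) a r s where "e = frag_of (a, r \<oplus>\<^bsub>R\<^esub> s) - frag_of (a, r) - frag_of (a, s)"
      "a \<in> carrier A" "r \<in> carrier R" "s \<in> carrier R"
    | (smult) k a r where "e = frag_of (k \<odot>\<^bsub>A\<^esub> a, r) - frag_of (a, k \<odot>\<^bsub>R\<^esub> r)"
      "k \<in> carrier K" "a \<in> carrier A" "r \<in> carrier R"
  using assms unfolding tensor_relations_def by blast

lemma frag_of_in_pairs: "\<lbrakk>a \<in> carrier A; r \<in> carrier R\<rbrakk> \<Longrightarrow> frag_of (a, r) \<in> carrier Q.F"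
  by simp

lemma tens_closed [simp, intro]:
  "\<lbrakk>a \<in> carrier A; r \<in> carrier R\<rbrakk> \<Longrightarrow> tens a r \<in> carrier T"
  unfolding T_carrier tens_def by (rule imageI) simp

lemma tens_add_left:
  assumes "a \<in> carrier A" "b \<in> carrier A" "r \<in> carrier R"
  shows "tens (a \<oplus>\<^bsub>A\<^esub> b) r = tens a r \<oplus>\<^bsub>T\<^esub> tens b r"
proof -
  have "Q.cls (frag_of (a \<oplus>\<^bsub>A\<^esub> b, r)) = Q.cls (frag_of (a, r) + frag_of (b, r))"
    using assms rel_add_left[OF assms]
    by (intro Q.cls_eqI Q.F_add) (simp_all add: diff_diff_eq)
  then show ?thesis using assms by (simp add: tens_def T_add)
qed

lemma tens_add_right:
  assumes "a \<in> carrier A" "r \<in> carrier R" "s \<in> carrier R"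
  shows "tens a (r \<oplus>\<^bsub>R\<^esub> s) = tens a r \<oplus>\<^bsub>T\<^esub> tens a s"
proof -
  have "Q.cls (frag_of (a, r \<oplus>\<^bsub>R\<^esub> s)) = Q.cls (frag_of (a, r) + frag_of (a, s))"
    using assms rel_add_right[OF assms]
    by (intro Q.cls_eqI Q.F_add) (simp_all add: diff_diff_eq)
  then show ?thesis using assms by (simp add: tens_def T_add)
qed

lemma tens_balanced:
  assumes "k \<in> carrier K" "a \<in> carrier A" "r \<in> carrier R"
  shows "tens (k \<odot>\<^bsub>A\<^esub> a) r = tens a (k \<odot>\<^bsub>R\<^esub> r)"
  unfolding tens_def using assms rel_smult[OF assms] by (intro Q.cls_eqI) simp_all

lemma tens_zero_left [simp]:
  assumes "r \<in> carrier R" shows "tens \<zero>\<^bsub>A\<^esub> r = \<zero>\<^bsub>T\<^esub>"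
  using tens_add_left[of "\<zero>\<^bsub>A\<^esub>" "\<zero>\<^bsub>A\<^esub>" r] assms
  by (metis A.M.r_zero A.M.zero_closed T.add.l_cancel_one' tens_closed)

lemma tens_zero_right [simp]:
  assumes "a \<in> carrier A" shows "tens a \<zero>\<^bsub>R\<^esub> = \<zero>\<^bsub>T\<^esub>"
  using tens_add_right[of a "\<zero>\<^bsub>R\<^esub>" "\<zero>\<^bsub>R\<^esub>"] assms
  by (metis R.M.r_zero R.M.zero_closed T.add.l_cancel_one' tens_closed)

lemma tens_minus:
  assumes "a \<in> carrier A" "r \<in> carrier R"
  shows "tens (\<ominus>\<^bsub>A\<^esub> a) r = \<ominus>\<^bsub>T\<^esub> tens a r"
proof (rule T.minus_equality[symmetric])
  show "tens (\<ominus>\<^bsub>A\<^esub> a) r \<oplus>\<^bsub>T\<^esub> tens a r = \<zero>\<^bsub>T\<^esub>"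
    using assms tens_add_left[of "\<ominus>\<^bsub>A\<^esub> a" a r] by (simp add: A.M.l_neg)
qed (use assms in auto)

text \<open>
  Closure under sums is sufficient because the negative of \<open>tens a r\<close> is \<open>tens (\<ominus> a) r\<close>.  In
  the proof the property is therefore carried along for an element and its negative together,
  and then the subtraction step of the induction for free abelian groups goes through.
\<close>

lemma tensor_induct [consumes 1, case_names tens add]:
  assumes t: "t \<in> carrier T"
    and tens: "\<And>a r. \<lbrakk>a \<in> carrier A; r \<in> carrier R\<rbrakk> \<Longrightarrow> P (tens a r)"
    and add: "\<And>s t. \<lbrakk>s \<in> carrier T; t \<in> carrier T; P s; P t\<rbrakk> \<Longrightarrow> P (s \<oplus>\<^bsub>T\<^esub> t)"
  shows "P t"
proof -
  obtain x where x: "Poly_Mapping.keys x \<subseteq> pairs" "t = Q.cls x"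
    using t unfolding T_carrier by auto
  have closed: "Q.cls x \<in> carrier T" if "Poly_Mapping.keys x \<subseteq> pairs" for x
    unfolding T_carrier using that by simp
  have minus: "Q.cls (x - y) = Q.cls x \<oplus>\<^bsub>T\<^esub> \<ominus>\<^bsub>T\<^esub> Q.cls y" "\<ominus>\<^bsub>T\<^esub> Q.cls (x - y) = Q.cls y \<oplus>\<^bsub>T\<^esub> \<ominus>\<^bsub>T\<^esub> Q.cls x"
    if "Poly_Mapping.keys x \<subseteq> pairs" "Poly_Mapping.keys y \<subseteq> pairs" for x y
  proof -
    have d: "Poly_Mapping.keys (x - y) \<subseteq> pairs" using keys_diff[of x y] that by blast
    have "Q.cls (x - y) \<oplus>\<^bsub>T\<^esub> Q.cls y = Q.cls x"
      using T_add[of "x - y" y] d that by simp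
    then show 1: "Q.cls (x - y) = Q.cls x \<oplus>\<^bsub>T\<^esub> \<ominus>\<^bsub>T\<^esub> Q.cls y"
      using closed d that by (metis T.a_inv_closed T.a_assoc T.r_neg T.r_zero)
    show "\<ominus>\<^bsub>T\<^esub> Q.cls (x - y) = Q.cls y \<oplus>\<^bsub>T\<^esub> \<ominus>\<^bsub>T\<^esub> Q.cls x"
      unfolding 1 using closed[OF that(1)] closed[OF that(2)]
      by (simp add: T.minus_add T.a_comm)
  qed
  from x(1) have "P (Q.cls x) \<and> P (\<ominus>\<^bsub>T\<^esub> Q.cls x)"
  proof (induction rule: free_Abelian_group_induct[consumes 1, case_names zero diff of])
    case zero
    have m: "\<ominus>\<^bsub>T\<^esub> \<zero>\<^bsub>T\<^esub> = \<zero>\<^bsub>T\<^esub>" using T.l_neg[OF T.zero_closed] by simp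
    have "P \<zero>\<^bsub>T\<^esub>" using tens[of "\<zero>\<^bsub>A\<^esub>" "\<zero>\<^bsub>R\<^esub>"] by simp
    then show ?case unfolding T_zero[symmetric] m by blast
  next
    case (diff x y)
    then show ?case using minus[OF diff(1,2)] add closed by simp
  next
    case (of p)
    obtain a r where p: "p = (a, r)" "a \<in> carrier A" "r \<in> carrier R" using of by auto
    then show ?case
      using tens[of a r] tens[of "\<ominus>\<^bsub>A\<^esub> a" r] tens_minus[of a r] by (simp add: tens_def)
  qed
  then show ?thesis using x(2) by simp
qed

text \<open>
  The additive extension of \<open>f\<close> to the free abelian group kills the defining relations and so
  factors through the quotient.
\<close>

lemma tensor_universal:
  assumes M: "abelian_group M"
    and closed: "\<And>a r. \<lbrakk>a \<in> carrier A; r \<in> carrier R\<rbrakk> \<Longrightarrow> f a r \<in> carrier M"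
    and left: "\<And>a b r. \<lbrakk>a \<in> carrier A; b \<in> carrier A; r \<in> carrier R\<rbrakk>
        \<Longrightarrow> f (a \<oplus>\<^bsub>A\<^esub> b) r = f a r \<oplus>\<^bsub>M\<^esub> f b r"
    and right: "\<And>a r s. \<lbrakk>a \<in> carrier A; r \<in> carrier R; s \<in> carrier R\<rbrakk>
        \<Longrightarrow> f a (r \<oplus>\<^bsub>R\<^esub> s) = f a r \<oplus>\<^bsub>M\<^esub> f a s"
    and bal: "\<And>k a r. \<lbrakk>k \<in> carrier K; a \<in> carrier A; r \<in> carrier R\<rbrakk>
        \<Longrightarrow> f (k \<odot>\<^bsub>A\<^esub> a) r = f a (k \<odot>\<^bsub>R\<^esub> r)"
  shows "\<exists>h. abelian_group_hom T M h \<and> (\<forall>a\<in>carrier A. \<forall>r\<in>carrier R. h (tens a r) = f a r)"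
proof -
  interpret M: abelian_group M by fact
  have "case_prod f ` pairs \<subseteq> carrier (add_monoid M)" using closed by auto
  then obtain g where g: "g \<in> hom Q.F (add_monoid M)"
    and g_of: "\<And>p. p \<in> pairs \<Longrightarrow> g (frag_of p) = case_prod f p"
    using comm_group.free_Abelian_group_universal[OF M.a_comm_group] by metis
  interpret g: group_hom Q.F "add_monoid M" g
    using g by (simp add: group_hom_def group_hom_axioms_def M.a_group)
  have g_diff: "g (x - y) = g x \<ominus>\<^bsub>M\<^esub> g y" if "x \<in> carrier Q.F" "y \<in> carrier Q.F" for x y
    using g.hom_mult[of x "- y"] g.hom_inv[of y] that
    by (simp add: a_minus_def a_inv_def)
  have cancel: "x \<oplus>\<^bsub>M\<^esub> y \<ominus>\<^bsub>M\<^esub> x \<ominus>\<^bsub>M\<^esub> y = \<zero>\<^bsub>M\<^esub>" if "x \<in> carrier M" "y \<in> carrier M" for x y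
    using that by (simp add: a_minus_def M.a_assoc[symmetric]) (simp add: M.a_assoc[of "x \<oplus>\<^bsub>M\<^esub> y"] M.minus_add[symmetric] M.r_neg)
  have self_cancel: "x \<ominus>\<^bsub>M\<^esub> x = \<zero>\<^bsub>M\<^esub>" if "x \<in> carrier M" for x
    using that by (simp add: a_minus_def M.r_neg)
  have "g e = \<zero>\<^bsub>M\<^esub>" if "e \<in> tensor_relations K A R" for e
    using that
    by (cases rule: tensor_relations_cases)
      (simp_all add: g_diff Q.F_diff g_of left right bal closed cancel self_cancel
        del: carrier_free_Abelian_group_iff add: frag_of_in_pairs)
  then have "tensor_relations K A R \<subseteq> kernel Q.F (add_monoid M) g"
    using subsetD[OF Q.E_subset] by (intro subsetI) (simp add: kernel_def)
  then have "Q.N \<subseteq> kernel Q.F (add_monoid M) g"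
    by (rule group.generate_subgroup_incl[OF group_free_Abelian_group _ g.subgroup_kernel])
  then obtain h where h: "h \<in> hom (Q.F Mod Q.N) (add_monoid M)"
    and h_cls: "\<And>x. x \<in> carrier Q.F \<Longrightarrow> h (Q.cls x) = g x"
    using g.FactGroup_universal_kernel[OF Q.N_normal] by metis
  have "h \<in> hom (add_monoid T) (add_monoid M)"
    using h by (simp add: hom_def poisson_tensor_def Let_def)
  then have "abelian_group_hom T M h"
    by (intro abelian_group_homI T_abelian_group M)
      (simp add: group_hom_def group_hom_axioms_def M.a_group T.a_group)
  moreover have "h (tens a r) = f a r" if "a \<in> carrier A" "r \<in> carrier R" for a r
    unfolding tens_def using that by (simp add: h_cls g_of)
  ultimately show ?thesis by blast
qed

lemma free_mult_bilinear:
  "free_mult A R = Q.bilinear_extend (\<lambda>p q. frag_of (fst p \<otimes>\<^bsub>A\<^esub> fst q, snd p \<otimes>\<^bsub>R\<^esub> snd q))"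
  by (simp add: fun_eq_iff free_mult_def Q.bilinear_extend_def case_prod_unfold)

lemma free_bracket_bilinear:
  "free_bracket A R = Q.bilinear_extend (\<lambda>p q.
    frag_of (\<lbrace>fst p, fst q\<rbrace>\<^bsub>A\<^esub>, snd p \<otimes>\<^bsub>R\<^esub> snd q) + frag_of (fst p \<otimes>\<^bsub>A\<^esub> fst q, \<lbrace>snd p, snd q\<rbrace>\<^bsub>R\<^esub>))"
  by (simp add: fun_eq_iff free_bracket_def Q.bilinear_extend_def case_prod_unfold)

lemma T_mult:
  assumes "x \<in> carrier Q.F" "y \<in> carrier Q.F"
  shows "Q.cls x \<otimes>\<^bsub>T\<^esub> Q.cls y = Q.cls (free_mult A R x y)"
proof -
  have "(\<Union>x'\<in>Q.cls x. \<Union>y'\<in>Q.cls y. Q.cls (free_mult A R x' y')) = Q.cls (free_mult A R x y)"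
    unfolding free_mult_bilinear
  proof (rule Q.bilinear_extend_cls[OF _ _ _ assms])
    fix e q assume "e \<in> tensor_relations K A R" and q: "q \<in> pairs"
    then show "Q.bilinear_extend (\<lambda>p q. frag_of (fst p \<otimes>\<^bsub>A\<^esub> fst q, snd p \<otimes>\<^bsub>R\<^esub> snd q)) e (frag_of q) \<in> Q.N"
      by (cases rule: tensor_relations_cases)
        (auto simp: Q.bilinear_extend_diff_left A.l_distr R.l_distr A.smult_assoc2 R.smult_assoc2
          rel_add_left rel_add_right rel_smult)
    from \<open>e \<in> _\<close>
    show "Q.bilinear_extend (\<lambda>p q. frag_of (fst p \<otimes>\<^bsub>A\<^esub> fst q, snd p \<otimes>\<^bsub>R\<^esub> snd q)) (frag_of q) e \<in> Q.N"
      by (cases rule: tensor_relations_cases)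
        (use q in \<open>auto simp: Q.bilinear_extend_diff_right A.r_distr R.r_distr
          A.mult_smult_right R.mult_smult_right rel_add_left rel_add_right rel_smult\<close>)
  qed auto
  then show ?thesis by (simp add: poisson_tensor_def Let_def)
qed

lemma T_bracket:
  assumes "x \<in> carrier Q.F" "y \<in> carrier Q.F"
  shows "\<lbrace>Q.cls x, Q.cls y\<rbrace>\<^bsub>T\<^esub> = Q.cls (free_bracket A R x y)"
proof -
  let ?h = "\<lambda>p q. frag_of (\<lbrace>fst p, fst q\<rbrace>\<^bsub>A\<^esub>, snd p \<otimes>\<^bsub>R\<^esub> snd q) + frag_of (fst p \<otimes>\<^bsub>A\<^esub> fst q, \<lbrace>snd p, snd q\<rbrace>\<^bsub>R\<^esub>)"
  have regroup3: "(x + x') - (y + y') - (z + z') \<in> Q.N" if "x - y - z \<in> Q.N" "x' - y' - z' \<in> Q.N"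
    for x y z x' y' z' :: "'a \<times> 'r \<Rightarrow>\<^sub>0 int"
    using Q.N_add[OF that] by (simp add: algebra_simps)
  have regroup2: "(x + x') - (y + y') \<in> Q.N" if "x - y \<in> Q.N" "x' - y' \<in> Q.N"
    for x y x' y' :: "'a \<times> 'r \<Rightarrow>\<^sub>0 int"
    using Q.N_add[OF that] by (simp add: algebra_simps)
  have "(\<Union>x'\<in>Q.cls x. \<Union>y'\<in>Q.cls y. Q.cls (free_bracket A R x' y')) = Q.cls (free_bracket A R x y)"
    unfolding free_bracket_bilinear
  proof (rule Q.bilinear_extend_cls[OF _ _ _ assms])
    fix e q assume e: "e \<in> tensor_relations K A R" and q: "q \<in> pairs"
    obtain c t where q': "q = (c, t)" "c \<in> carrier A" "t \<in> carrier R" using q by auto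
    from e show "Q.bilinear_extend ?h e (frag_of q) \<in> Q.N"
    proof (cases rule: tensor_relations_cases)
      case (left a b r)
      then show ?thesis using q'
        by (simp add: Q.bilinear_extend_diff_left A.l_distr A.bracket_add_left regroup3 rel_add_left)
    next
      case (right a r s)
      then show ?thesis using q'
        by (simp add: Q.bilinear_extend_diff_left R.l_distr R.bracket_add_left regroup3 rel_add_right)
    next
      case (smult k a r)
      then show ?thesis using q'
        by (simp add: Q.bilinear_extend_diff_left A.smult_assoc2 R.smult_assoc2
          A.bracket_smult_left R.bracket_smult_left regroup2 rel_smult)
    qed
    from e show "Q.bilinear_extend ?h (frag_of q) e \<in> Q.N"
    proof (cases rule: tensor_relations_cases)
      case (left a b r)
      then show ?thesis using q'
        by (simp add: Q.bilinear_extend_diff_right A.r_distr A.bracket_add_right regroup3 rel_add_left)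
    next
      case (right a r s)
      then show ?thesis using q'
        by (simp add: Q.bilinear_extend_diff_right R.r_distr R.bracket_add_right regroup3 rel_add_right)
    next
      case (smult k a r)
      then show ?thesis using q'
        by (simp add: Q.bilinear_extend_diff_right A.mult_smult_right R.mult_smult_right
          A.bracket_smult_right R.bracket_smult_right regroup2 rel_smult)
    qed
  next
    fix p q assume "p \<in> pairs" "q \<in> pairs"
    then show "?h p q \<in> carrier Q.F" by (intro Q.F_add) auto
  qed
  then show ?thesis by (simp add: poisson_tensor_def Let_def)
qed

lemma T_smult:
  assumes "k \<in> carrier K" "x \<in> carrier Q.F"
  shows "k \<odot>\<^bsub>T\<^esub> Q.cls x = Q.cls (free_smult A k x)"
proof -
  have "(\<Union>x'\<in>Q.cls x. Q.cls (free_smult A k x')) = Q.cls (free_smult A k x)"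
    unfolding free_smult_def
  proof (rule Q.frag_extend_cls[OF _ _ assms(2)])
    fix e assume "e \<in> tensor_relations K A R"
    then show "frag_extend (\<lambda>(a, r). frag_of (k \<odot>\<^bsub>A\<^esub> a, r)) e \<in> Q.N"
    proof (cases rule: tensor_relations_cases)
      case (smult l a r)
      have "k \<odot>\<^bsub>A\<^esub> (l \<odot>\<^bsub>A\<^esub> a) = l \<odot>\<^bsub>A\<^esub> (k \<odot>\<^bsub>A\<^esub> a)"
        using smult assms(1) by (simp add: A.smult_assoc1[symmetric] A.K.m_comm)
      then show ?thesis using smult assms(1) by (simp add: frag_extend_diff rel_smult)
    qed (use assms(1) in \<open>simp_all add: frag_extend_diff A.smult_r_distr rel_add_left rel_add_right\<close>)
  qed (use assms(1) in auto)
  then show ?thesis by (simp add: poisson_tensor_def Let_def)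
qed

lemma tens_mult:
  "\<lbrakk>a \<in> carrier A; b \<in> carrier A; r \<in> carrier R; s \<in> carrier R\<rbrakk>
    \<Longrightarrow> tens a r \<otimes>\<^bsub>T\<^esub> tens b s = tens (a \<otimes>\<^bsub>A\<^esub> b) (r \<otimes>\<^bsub>R\<^esub> s)"
  by (simp add: tens_def T_mult free_mult_def)

lemma tens_bracket:
  assumes "a \<in> carrier A" "b \<in> carrier A" "r \<in> carrier R" "s \<in> carrier R"
  shows "\<lbrace>tens a r, tens b s\<rbrace>\<^bsub>T\<^esub> = tens \<lbrace>a, b\<rbrace>\<^bsub>A\<^esub> (r \<otimes>\<^bsub>R\<^esub> s) \<oplus>\<^bsub>T\<^esub> tens (a \<otimes>\<^bsub>A\<^esub> b) \<lbrace>r, s\<rbrace>\<^bsub>R\<^esub>"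
  using assms by (simp add: tens_def T_bracket T_add free_bracket_def)

lemma tens_smult:
  "\<lbrakk>k \<in> carrier K; a \<in> carrier A; r \<in> carrier R\<rbrakk> \<Longrightarrow> k \<odot>\<^bsub>T\<^esub> tens a r = tens (k \<odot>\<^bsub>A\<^esub> a) r"
  by (simp add: tens_def T_smult free_smult_def)

lemma T_biadditive: "biadditive_algebra K T"
proof -
  have mult: "free_mult A R x y \<in> carrier Q.F" if "x \<in> carrier Q.F" "y \<in> carrier Q.F" for x y
    unfolding free_mult_bilinear using that by (intro Q.bilinear_extend_carrier) auto
  have lie: "free_bracket A R x y \<in> carrier Q.F" if "x \<in> carrier Q.F" "y \<in> carrier Q.F" for x y
    unfolding free_bracket_bilinear using that by (intro Q.bilinear_extend_carrier Q.F_add) auto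
  have smult: "free_smult A k x \<in> carrier Q.F" if "k \<in> carrier K" "x \<in> carrier Q.F" for k x
    unfolding free_smult_def using that by (intro Q.F_frag_extend) auto
  note [simp] = T_mult T_bracket T_smult T_add mult lie smult Q.F_add
  note [simp del] = carrier_free_Abelian_group_iff
  show ?thesis
  proof
    fix X Y assume "X \<in> carrier T" "Y \<in> carrier T"
    then obtain x y where xy: "x \<in> carrier Q.F" "y \<in> carrier Q.F" "X = Q.cls x" "Y = Q.cls y"
      unfolding T_carrier by blast
    show "X \<otimes>\<^bsub>T\<^esub> Y \<in> carrier T" "\<lbrace>X, Y\<rbrace>\<^bsub>T\<^esub> \<in> carrier T"
      using xy by (auto simp: T_carrier)
    show "k \<odot>\<^bsub>T\<^esub> X \<in> carrier T" "k \<odot>\<^bsub>T\<^esub> (X \<oplus>\<^bsub>T\<^esub> Y) = k \<odot>\<^bsub>T\<^esub> X \<oplus>\<^bsub>T\<^esub> k \<odot>\<^bsub>T\<^esub> Y"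
      if "k \<in> carrier K" for k
      using xy that by (simp_all add: T_carrier) (simp add: free_smult_def frag_extend_add)
    fix Z assume "Z \<in> carrier T"
    then obtain z where z: "z \<in> carrier Q.F" "Z = Q.cls z"
      unfolding T_carrier by blast
    show "(X \<oplus>\<^bsub>T\<^esub> Y) \<otimes>\<^bsub>T\<^esub> Z = X \<otimes>\<^bsub>T\<^esub> Z \<oplus>\<^bsub>T\<^esub> Y \<otimes>\<^bsub>T\<^esub> Z"
      "X \<otimes>\<^bsub>T\<^esub> (Y \<oplus>\<^bsub>T\<^esub> Z) = X \<otimes>\<^bsub>T\<^esub> Y \<oplus>\<^bsub>T\<^esub> X \<otimes>\<^bsub>T\<^esub> Z"
      "\<lbrace>X \<oplus>\<^bsub>T\<^esub> Y, Z\<rbrace>\<^bsub>T\<^esub> = \<lbrace>X, Z\<rbrace>\<^bsub>T\<^esub> \<oplus>\<^bsub>T\<^esub> \<lbrace>Y, Z\<rbrace>\<^bsub>T\<^esub>"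
      "\<lbrace>X, Y \<oplus>\<^bsub>T\<^esub> Z\<rbrace>\<^bsub>T\<^esub> = \<lbrace>X, Y\<rbrace>\<^bsub>T\<^esub> \<oplus>\<^bsub>T\<^esub> \<lbrace>X, Z\<rbrace>\<^bsub>T\<^esub>"
      using xy z by (simp_all, simp_all add: free_mult_bilinear free_bracket_bilinear
          Q.bilinear_extend_add_left Q.bilinear_extend_add_right)
  qed
qed

sublocale TB: biadditive_algebra K T by (rule T_biadditive)

lemma T_one_closed: "\<one>\<^bsub>T\<^esub> \<in> carrier T"
  by (simp add: T_one)

text \<open>
  Each multiplicativity law is an equation between additive functions of every argument, so pure
  tensors decide it.
\<close>

lemma tensor_poisson_homI:
  assumes M: "biadditive_algebra K M" and h: "abelian_group_hom T M h"
    and one: "h \<one>\<^bsub>T\<^esub> = \<one>\<^bsub>M\<^esub>"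
    and smult: "\<And>k a r. \<lbrakk>k \<in> carrier K; a \<in> carrier A; r \<in> carrier R\<rbrakk>
        \<Longrightarrow> h (tens (k \<odot>\<^bsub>A\<^esub> a) r) = k \<odot>\<^bsub>M\<^esub> h (tens a r)"
    and mult: "\<And>a b r s. \<lbrakk>a \<in> carrier A; b \<in> carrier A; r \<in> carrier R; s \<in> carrier R\<rbrakk>
        \<Longrightarrow> h (tens (a \<otimes>\<^bsub>A\<^esub> b) (r \<otimes>\<^bsub>R\<^esub> s)) = h (tens a r) \<otimes>\<^bsub>M\<^esub> h (tens b s)"
    and lie: "\<And>a b r s. \<lbrakk>a \<in> carrier A; b \<in> carrier A; r \<in> carrier R; s \<in> carrier R\<rbrakk>
        \<Longrightarrow> h (tens \<lbrace>a, b\<rbrace>\<^bsub>A\<^esub> (r \<otimes>\<^bsub>R\<^esub> s)) \<oplus>\<^bsub>M\<^esub> h (tens (a \<otimes>\<^bsub>A\<^esub> b) \<lbrace>r, s\<rbrace>\<^bsub>R\<^esub>)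
          = \<lbrace>h (tens a r), h (tens b s)\<rbrace>\<^bsub>M\<^esub>"
  shows "h \<in> poisson_hom K T M"
proof -
  interpret M: biadditive_algebra K M by fact
  interpret h: abelian_group_hom T M h by fact
  have 1: "h (k \<odot>\<^bsub>T\<^esub> t) = k \<odot>\<^bsub>M\<^esub> h t" if "t \<in> carrier T" "k \<in> carrier K" for k t
    using that
    by (induction rule: tensor_induct) (simp_all add: tens_smult smult TB.scale_add M.scale_add)
  have 2: "h (s \<otimes>\<^bsub>T\<^esub> t) = h s \<otimes>\<^bsub>M\<^esub> h t \<and> h \<lbrace>s, t\<rbrace>\<^bsub>T\<^esub> = \<lbrace>h s, h t\<rbrace>\<^bsub>M\<^esub>"
    if "s \<in> carrier T" "t \<in> carrier T" for s t
    using that(1)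
  proof (induction rule: tensor_induct)
    case (tens a r)
    from that(2) show ?case
      by (induction rule: tensor_induct)
        (use tens in \<open>simp_all add: tens_mult tens_bracket mult lie TB.mult_add_right M.mult_add_right
          TB.lie_add_right M.lie_add_right\<close>)
  next
    case (add s s')
    then show ?case using that(2)
      by (simp add: TB.mult_add_left M.mult_add_left TB.lie_add_left M.lie_add_left)
  qed
  show ?thesis
    unfolding poisson_hom_def ring_hom_def using 1 2 one by auto
qed

end

section \<open>Linear functionals\<close>

definition functionals :: "('k, 'n) ring_scheme \<Rightarrow> ('k, 'v, 'm) module_scheme \<Rightarrow> ('v \<Rightarrow> 'k) set"
  where "functionals K V = {\<phi> \<in> carrier V \<rightarrow> carrier K.
    (\<forall>v \<in> carrier V. \<forall>w \<in> carrier V. \<phi> (v \<oplus>\<^bsub>V\<^esub> w) = \<phi> v \<oplus>\<^bsub>K\<^esub> \<phi> w) \<and>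
    (\<forall>k \<in> carrier K. \<forall>v \<in> carrier V. \<phi> (k \<odot>\<^bsub>V\<^esub> v) = k \<otimes>\<^bsub>K\<^esub> \<phi> v)}"

lemma functionalsD:
  assumes "\<phi> \<in> functionals K V"
  shows "v \<in> carrier V \<Longrightarrow> \<phi> v \<in> carrier K"
    and "\<lbrakk>v \<in> carrier V; w \<in> carrier V\<rbrakk> \<Longrightarrow> \<phi> (v \<oplus>\<^bsub>V\<^esub> w) = \<phi> v \<oplus>\<^bsub>K\<^esub> \<phi> w"
    and "\<lbrakk>k \<in> carrier K; v \<in> carrier V\<rbrakk> \<Longrightarrow> \<phi> (k \<odot>\<^bsub>V\<^esub> v) = k \<otimes>\<^bsub>K\<^esub> \<phi> v"
  using assms by (auto simp: functionals_def)

definition adjoin_line :: "('k, 'n) ring_scheme \<Rightarrow> ('k, 'v, 'm) module_scheme \<Rightarrow> 'v \<Rightarrow> 'v set \<Rightarrow> 'v set"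
  where "adjoin_line K V x U = {u \<oplus>\<^bsub>V\<^esub> k \<odot>\<^bsub>V\<^esub> x | u k. u \<in> U \<and> k \<in> carrier K}"

context module
begin

lemma adjoin_line_submodule:
  assumes U: "submodule U R M" and x: "x \<in> carrier M"
  shows "submodule (adjoin_line R M x U) R M" "U \<subseteq> adjoin_line R M x U" "x \<in> adjoin_line R M x U"
proof -
  note UE = submoduleE[OF U]
  have zero: "\<zero>\<^bsub>M\<^esub> \<in> U" using subgroup.one_closed[OF submodule.axioms(1)[OF U]] by simp
  have Uc: "u \<in> carrier M" if "u \<in> U" for u using UE(1) that by blast
  show sub: "U \<subseteq> adjoin_line R M x U"
  proof
    fix u assume u: "u \<in> U"
    then have "u = u \<oplus>\<^bsub>M\<^esub> \<zero> \<odot>\<^bsub>M\<^esub> x" using x Uc by simp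
    then show "u \<in> adjoin_line R M x U" unfolding adjoin_line_def using u by blast
  qed
  have "x = \<zero>\<^bsub>M\<^esub> \<oplus>\<^bsub>M\<^esub> \<one> \<odot>\<^bsub>M\<^esub> x" using x by simp
  then show "x \<in> adjoin_line R M x U" unfolding adjoin_line_def using zero by blast
  show "submodule (adjoin_line R M x U) R M"
  proof (rule submoduleI)
    show "adjoin_line R M x U \<subseteq> carrier M" using x Uc by (auto simp: adjoin_line_def)
    show "\<zero>\<^bsub>M\<^esub> \<in> adjoin_line R M x U" using sub zero by blast
  next
    fix a assume "a \<in> adjoin_line R M x U"
    then obtain u k where a: "a = u \<oplus>\<^bsub>M\<^esub> k \<odot>\<^bsub>M\<^esub> x" "u \<in> U" "k \<in> carrier R"
      by (auto simp: adjoin_line_def)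
    have "\<ominus>\<^bsub>M\<^esub> a = \<ominus>\<^bsub>M\<^esub> u \<oplus>\<^bsub>M\<^esub> (\<ominus> k) \<odot>\<^bsub>M\<^esub> x"
      using a x Uc by (simp add: M.minus_add smult_l_minus)
    then show "\<ominus>\<^bsub>M\<^esub> a \<in> adjoin_line R M x U"
      unfolding adjoin_line_def using UE(3)[OF a(2)] a(3) by blast
    fix c assume c: "c \<in> carrier R"
    have "c \<odot>\<^bsub>M\<^esub> a = c \<odot>\<^bsub>M\<^esub> u \<oplus>\<^bsub>M\<^esub> (c \<otimes> k) \<odot>\<^bsub>M\<^esub> x"
      using a x Uc c by (simp add: smult_r_distr smult_assoc1)
    then show "c \<odot>\<^bsub>M\<^esub> a \<in> adjoin_line R M x U"
      unfolding adjoin_line_def using UE(4)[OF c a(2)] a(3) c by blast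
  next
    fix a b assume "a \<in> adjoin_line R M x U" "b \<in> adjoin_line R M x U"
    then obtain u k v l where ab: "a = u \<oplus>\<^bsub>M\<^esub> k \<odot>\<^bsub>M\<^esub> x" "u \<in> U" "k \<in> carrier R"
      "b = v \<oplus>\<^bsub>M\<^esub> l \<odot>\<^bsub>M\<^esub> x" "v \<in> U" "l \<in> carrier R"
      by (auto simp: adjoin_line_def)
    have "a \<oplus>\<^bsub>M\<^esub> b = (u \<oplus>\<^bsub>M\<^esub> v) \<oplus>\<^bsub>M\<^esub> (k \<oplus> l) \<odot>\<^bsub>M\<^esub> x"
      using ab x Uc by (simp add: smult_l_distr M.a_ac)
    then show "a \<oplus>\<^bsub>M\<^esub> b \<in> adjoin_line R M x U"
      unfolding adjoin_line_def using UE(5)[OF ab(2,5)] ab(3,6) by blast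
  qed
qed

text \<open>
  Zorn's lemma: the union of a nonempty chain of submodules that avoid \<open>x\<close> is again one.
\<close>

lemma maximal_submodule_avoiding:
  assumes W: "submodule W R M" and x: "x \<notin> W"
  obtains U where "submodule U R M" "W \<subseteq> U" "x \<notin> U"
    "\<And>U'. \<lbrakk>submodule U' R M; U \<subseteq> U'; x \<notin> U'\<rbrakk> \<Longrightarrow> U' = U"
proof -
  define \<A> where "\<A> = {U. submodule U R M \<and> W \<subseteq> U \<and> x \<notin> U}"
  have "\<exists>U\<in>\<A>. \<forall>U'\<in>\<A>. U \<subseteq> U' \<longrightarrow> U' = U"
  proof (rule subset_Zorn_nonempty)
    show "\<A> \<noteq> {}" using W x by (auto simp: \<A>_def)
    fix C assume C: "C \<noteq> {}" "subset.chain \<A> C"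
    have mem: "submodule U R M" "W \<subseteq> U" "x \<notin> U" if "U \<in> C" for U
      using C(2) that by (auto simp: subset_chain_def \<A>_def)
    have "submodule (\<Union>C) R M"
    proof (rule submoduleI)
      show "\<Union>C \<subseteq> carrier M" using mem submoduleE(1) by blast
      obtain U where U: "U \<in> C" using C(1) by blast
      then show "\<zero>\<^bsub>M\<^esub> \<in> \<Union>C"
        using subgroup.one_closed[OF submodule.axioms(1)[OF mem(1)[OF U]]] by auto
    next
      fix a assume "a \<in> \<Union>C"
      then obtain U where U: "a \<in> U" "U \<in> C" by blast
      then show "\<ominus>\<^bsub>M\<^esub> a \<in> \<Union>C" using submoduleE(3)[OF mem(1)] by blast
      show "k \<odot>\<^bsub>M\<^esub> a \<in> \<Union>C" if "k \<in> carrier R" for k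
        using submoduleE(4)[OF mem(1)[OF U(2)] that U(1)] U(2) by blast
    next
      fix a b assume "a \<in> \<Union>C" "b \<in> \<Union>C"
      then obtain U V where UV: "a \<in> U" "U \<in> C" "b \<in> V" "V \<in> C" by blast
      then have "U \<subseteq> V \<or> V \<subseteq> U" using C(2) by (auto simp: subset_chain_def)
      then obtain Z where "Z \<in> C" "a \<in> Z" "b \<in> Z" using UV by blast
      then show "a \<oplus>\<^bsub>M\<^esub> b \<in> \<Union>C" using submoduleE(5)[OF mem(1)] by blast
    qed
    moreover have "W \<subseteq> \<Union>C" "x \<notin> \<Union>C" using C(1) mem(2,3) by blast+
    ultimately show "\<Union>C \<in> \<A>" by (simp add: \<A>_def)
  qed
  then obtain U where "U \<in> \<A>" "\<And>U'. \<lbrakk>U' \<in> \<A>; U \<subseteq> U'\<rbrakk> \<Longrightarrow> U' = U" by blast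
  then show thesis using that[of U] unfolding \<A>_def by blast
qed

text \<open>
  Let \<open>U\<close> be maximal among the submodules that contain \<open>W\<close> and avoid \<open>x\<close>.  If \<open>v\<close> is not in
  \<open>U\<close>, then \<open>U + K v\<close> contains \<open>x\<close>, say \<open>x = u + k v\<close>; here \<open>k \<noteq> 0\<close>, so \<open>v\<close> differs from
  \<open>k\<^sup>-\<^sup>1 x\<close> by an element of \<open>U\<close>.  Thus the whole space is the direct sum of \<open>U\<close> and
  the line through \<open>x\<close>, and the coefficient of \<open>x\<close> is the desired functional.
\<close>

lemma separating_functional:
  assumes R: "field R" and W: "submodule W R M" and x: "x \<in> carrier M" "x \<notin> W"
  obtains \<phi> where "\<phi> \<in> functionals R M" "\<And>w. w \<in> W \<Longrightarrow> \<phi> w = \<zero>" "\<phi> x = \<one>"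
proof -
  interpret R: field R by fact
  obtain U where U: "submodule U R M" "W \<subseteq> U" "x \<notin> U"
    and max: "\<And>U'. \<lbrakk>submodule U' R M; U \<subseteq> U'; x \<notin> U'\<rbrakk> \<Longrightarrow> U' = U"
    using maximal_submodule_avoiding[OF W x(2)] by blast
  note UE = submoduleE[OF U(1)]
  have Uc: "u \<in> carrier M" if "u \<in> U" for u using UE(1) that by blast
  have zero: "\<zero>\<^bsub>M\<^esub> \<in> U" using subgroup.one_closed[OF submodule.axioms(1)[OF U(1)]] by simp
  have minus: "u \<ominus>\<^bsub>M\<^esub> v \<in> U" if "u \<in> U" "v \<in> U" for u v
    using UE(3,5) that by (simp add: a_minus_def)
  have inv: "inv k \<in> carrier R" "inv k \<otimes> k = \<one>" if "k \<in> carrier R" "k \<noteq> \<zero>" for k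
    using that R.field_Units R.Units_l_inv R.Units_inv_closed by auto
  have ex: "\<exists>c\<in>carrier R. v \<ominus>\<^bsub>M\<^esub> c \<odot>\<^bsub>M\<^esub> x \<in> U" if v: "v \<in> carrier M" for v
  proof (cases "v \<in> U")
    case True
    then show ?thesis using x v by (intro bexI[of _ \<zero>]) (auto simp: a_minus_def M.minus_equality[of "\<zero>\<^bsub>M\<^esub>"])
  next
    case False
    have "x \<in> adjoin_line R M v U"
      using max[OF adjoin_line_submodule(1,2)[OF U(1) v]] adjoin_line_submodule(3)[OF U(1) v] False by blast
    then obtain u k where uk: "x = u \<oplus>\<^bsub>M\<^esub> k \<odot>\<^bsub>M\<^esub> v" "u \<in> U" "k \<in> carrier R"
      by (auto simp: adjoin_line_def)
    have k: "k \<noteq> \<zero>" using uk U(3) v Uc[OF uk(2)] by auto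
    note i = inv[OF uk(3) k]
    have "inv k \<odot>\<^bsub>M\<^esub> x = inv k \<odot>\<^bsub>M\<^esub> u \<oplus>\<^bsub>M\<^esub> v"
      using uk i v Uc by (simp add: smult_r_distr smult_assoc1[symmetric])
    moreover have "v \<ominus>\<^bsub>M\<^esub> (y \<oplus>\<^bsub>M\<^esub> v) = \<ominus>\<^bsub>M\<^esub> y" if "y \<in> carrier M" for y
    proof -
      have "v \<ominus>\<^bsub>M\<^esub> (y \<oplus>\<^bsub>M\<^esub> v) = v \<oplus>\<^bsub>M\<^esub> (\<ominus>\<^bsub>M\<^esub> v \<oplus>\<^bsub>M\<^esub> \<ominus>\<^bsub>M\<^esub> y)"
        using v that by (simp add: a_minus_def M.minus_add M.a_comm)
      then show ?thesis using v that by (simp add: M.r_neg2)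
    qed
    ultimately have "v \<ominus>\<^bsub>M\<^esub> inv k \<odot>\<^bsub>M\<^esub> x = \<ominus>\<^bsub>M\<^esub> (inv k \<odot>\<^bsub>M\<^esub> u)"
      using i uk Uc by simp
    also have "\<dots> \<in> U" using UE(3,4) i uk by blast
    finally show ?thesis using i by blast
  qed
  have uniq: "c = d" if cd: "c \<in> carrier R" "d \<in> carrier R" and v: "v \<in> carrier M"
    and U': "v \<ominus>\<^bsub>M\<^esub> c \<odot>\<^bsub>M\<^esub> x \<in> U" "v \<ominus>\<^bsub>M\<^esub> d \<odot>\<^bsub>M\<^esub> x \<in> U" for c d v
  proof (rule ccontr)
    assume "c \<noteq> d"
    then have "d \<ominus> c \<noteq> \<zero>" using cd by simp
    note i = inv[OF R.minus_closed[OF cd(2,1)] this]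
    have "(v \<ominus>\<^bsub>M\<^esub> c \<odot>\<^bsub>M\<^esub> x) \<ominus>\<^bsub>M\<^esub> (v \<ominus>\<^bsub>M\<^esub> d \<odot>\<^bsub>M\<^esub> x) = (d \<ominus> c) \<odot>\<^bsub>M\<^esub> x"
      using cd v x by (simp add: a_minus_def M.minus_add M.a_ac M.r_neg1 M.r_neg2 smult_l_distr smult_l_minus)
    then have "(d \<ominus> c) \<odot>\<^bsub>M\<^esub> x \<in> U" using minus[OF U'] by simp
    then have "inv (d \<ominus> c) \<odot>\<^bsub>M\<^esub> ((d \<ominus> c) \<odot>\<^bsub>M\<^esub> x) \<in> U" using UE(4) i by blast
    then show False using U(3) i x cd by (simp add: smult_assoc1[symmetric])
  qed
  define \<phi> where "\<phi> v = (SOME c. c \<in> carrier R \<and> v \<ominus>\<^bsub>M\<^esub> c \<odot>\<^bsub>M\<^esub> x \<in> U)" for v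
  have \<phi>: "\<phi> v \<in> carrier R" "v \<ominus>\<^bsub>M\<^esub> \<phi> v \<odot>\<^bsub>M\<^esub> x \<in> U" if "v \<in> carrier M" for v
    using someI_ex[of "\<lambda>c. c \<in> carrier R \<and> v \<ominus>\<^bsub>M\<^esub> c \<odot>\<^bsub>M\<^esub> x \<in> U"] ex[OF that] unfolding \<phi>_def by blast+
  have \<phi>_eq: "\<phi> v = c" if "c \<in> carrier R" "v \<in> carrier M" "v \<ominus>\<^bsub>M\<^esub> c \<odot>\<^bsub>M\<^esub> x \<in> U" for v c
    using uniq \<phi> that by blast
  have "\<phi> \<in> functionals R M"
    unfolding functionals_def
  proof (intro CollectI conjI ballI)
    fix v w assume vw: "v \<in> carrier M" "w \<in> carrier M"
    have "(v \<oplus>\<^bsub>M\<^esub> w) \<ominus>\<^bsub>M\<^esub> (\<phi> v \<oplus> \<phi> w) \<odot>\<^bsub>M\<^esub> x = (v \<ominus>\<^bsub>M\<^esub> \<phi> v \<odot>\<^bsub>M\<^esub> x) \<oplus>\<^bsub>M\<^esub> (w \<ominus>\<^bsub>M\<^esub> \<phi> w \<odot>\<^bsub>M\<^esub> x)"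
      using vw \<phi> x by (simp add: a_minus_def smult_l_distr M.minus_add M.a_ac)
    then show "\<phi> (v \<oplus>\<^bsub>M\<^esub> w) = \<phi> v \<oplus> \<phi> w"
      using UE(5)[OF \<phi>(2)[OF vw(1)] \<phi>(2)[OF vw(2)]] vw \<phi> by (intro \<phi>_eq) auto
  next
    fix k v assume kv: "k \<in> carrier R" "v \<in> carrier M"
    have "k \<odot>\<^bsub>M\<^esub> v \<ominus>\<^bsub>M\<^esub> (k \<otimes> \<phi> v) \<odot>\<^bsub>M\<^esub> x = k \<odot>\<^bsub>M\<^esub> (v \<ominus>\<^bsub>M\<^esub> \<phi> v \<odot>\<^bsub>M\<^esub> x)"
      using kv \<phi> x by (simp add: a_minus_def smult_r_distr smult_assoc1 smult_r_minus)
    then show "\<phi> (k \<odot>\<^bsub>M\<^esub> v) = k \<otimes> \<phi> v"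
      using UE(4)[OF kv(1) \<phi>(2)[OF kv(2)]] kv \<phi> by (intro \<phi>_eq) auto
  qed (use \<phi> in auto)
  moreover have "\<phi> w = \<zero>" if "w \<in> W" for w
    using that U(2) Uc x by (intro \<phi>_eq) (auto simp: a_minus_def M.minus_equality[of "\<zero>\<^bsub>M\<^esub>"])
  moreover have "\<phi> x = \<one>"
    using x zero by (intro \<phi>_eq) (auto simp: a_minus_def M.r_neg)
  ultimately show thesis using that by blast
qed

end

section \<open>The Poisson center of a tensor product\<close>

context poisson_pair
begin

text \<open>
  The map \<open>id \<otimes> \<phi>\<close> from \<open>A \<otimes> R\<close> to \<open>A \<otimes> K = A\<close>; lemma \<open>slice\<close> shows that the choice
  made here succeeds.
\<close>

definition slice :: "('r \<Rightarrow> 'k) \<Rightarrow> ('a \<times> 'r \<Rightarrow>\<^sub>0 int) set \<Rightarrow> 'a"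
  where "slice \<phi> = (SOME h. abelian_group_hom T A h \<and>
    (\<forall>a\<in>carrier A. \<forall>r\<in>carrier R. h (tens a r) = \<phi> r \<odot>\<^bsub>A\<^esub> a))"

lemma slice:
  assumes \<phi>: "\<phi> \<in> functionals K R"
  shows "abelian_group_hom T A (slice \<phi>)"
    and "\<lbrakk>a \<in> carrier A; r \<in> carrier R\<rbrakk> \<Longrightarrow> slice \<phi> (tens a r) = \<phi> r \<odot>\<^bsub>A\<^esub> a"
proof -
  note [simp] = functionalsD[OF \<phi>]
  have "\<exists>h. abelian_group_hom T A h \<and> (\<forall>a\<in>carrier A. \<forall>r\<in>carrier R. h (tens a r) = \<phi> r \<odot>\<^bsub>A\<^esub> a)"
    by (rule tensor_universal)
      (simp_all add: A.M.abelian_group_axioms A.smult_r_distr A.smult_l_distr A.smult_assoc1[symmetric]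
        A.K.m_comm)
  from someI_ex[OF this]
  show "abelian_group_hom T A (slice \<phi>)"
    and "\<lbrakk>a \<in> carrier A; r \<in> carrier R\<rbrakk> \<Longrightarrow> slice \<phi> (tens a r) = \<phi> r \<odot>\<^bsub>A\<^esub> a"
    unfolding slice_def by blast+
qed

text \<open>
  Bracketing with \<open>b \<otimes> 1\<close> commutes with \<open>id \<otimes> \<phi>\<close>, because \<open>1\<close> brackets to zero in \<open>R\<close>:
  \<open>{a \<otimes> r, b \<otimes> 1} = {a, b} \<otimes> r\<close>.
\<close>

lemma slice_center:
  assumes \<phi>: "\<phi> \<in> functionals K R" and t: "t \<in> poisson_center T"
  shows "slice \<phi> t \<in> poisson_center A"
proof -
  interpret h: abelian_group_hom T A "slice \<phi>" by (rule slice(1)[OF \<phi>])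
  note [simp] = functionalsD[OF \<phi>] slice(2)[OF \<phi>]
  have t': "t \<in> carrier T" and central: "\<And>s. s \<in> carrier T \<Longrightarrow> \<lbrace>t, s\<rbrace>\<^bsub>T\<^esub> = \<zero>\<^bsub>T\<^esub>"
    using t by (auto simp: poisson_center_def)
  have eq: "slice \<phi> \<lbrace>s, tens b \<one>\<^bsub>R\<^esub>\<rbrace>\<^bsub>T\<^esub> = \<lbrace>slice \<phi> s, b\<rbrace>\<^bsub>A\<^esub>" if b: "b \<in> carrier A" and s: "s \<in> carrier T" for b s
    using s
  proof (induction rule: tensor_induct)
    case (tens a r)
    then show ?case using b
      by (simp add: tens_bracket R.bracket_one_right A.bracket_smult_left)
  next
    case (add s s')
    then show ?case using b
      by (simp add: TB.lie_add_left A.bracket_add_left)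
  qed
  show ?thesis
    unfolding poisson_center_def
  proof (intro CollectI conjI ballI)
    fix b assume b: "b \<in> carrier A"
    show "\<lbrace>slice \<phi> t, b\<rbrace>\<^bsub>A\<^esub> = \<zero>\<^bsub>A\<^esub>"
      using eq[OF b t'] central[of "tens b \<one>\<^bsub>R\<^esub>"] b by simp
  qed (use t' in simp)
qed

fun span :: "'r list \<Rightarrow> 'r set" where
  "span [] = {\<zero>\<^bsub>R\<^esub>}"
| "span (r # rs) = adjoin_line K R r (span rs)"

fun tensor_span :: "'r list \<Rightarrow> ('a \<times> 'r \<Rightarrow>\<^sub>0 int) set set" where
  "tensor_span [] = {\<zero>\<^bsub>T\<^esub>}"
| "tensor_span (r # rs) = {tens a r \<oplus>\<^bsub>T\<^esub> t | a t. a \<in> carrier A \<and> t \<in> tensor_span rs}"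

lemma span_submodule: "set rs \<subseteq> carrier R \<Longrightarrow> submodule (span rs) K R"
proof (induction rs)
  case Nil
  show ?case
    by (rule R.submoduleI) (use R.M.l_neg[OF R.M.zero_closed] in auto)
next
  case (Cons r rs)
  then show ?case using R.adjoin_line_submodule(1) by simp
qed

lemma tensor_span_carrier: "set rs \<subseteq> carrier R \<Longrightarrow> tensor_span rs \<subseteq> carrier T"
  by (induction rs) auto

lemma tensor_span_add:
  assumes "set rs \<subseteq> carrier R" "s \<in> tensor_span rs" "t \<in> tensor_span rs"
  shows "s \<oplus>\<^bsub>T\<^esub> t \<in> tensor_span rs"
  using assms
proof (induction rs arbitrary: s t)
  case (Cons r rs)
  then obtain a b s' t' where st: "s = tens a r \<oplus>\<^bsub>T\<^esub> s'" "t = tens b r \<oplus>\<^bsub>T\<^esub> t'"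
    "a \<in> carrier A" "b \<in> carrier A" "s' \<in> tensor_span rs" "t' \<in> tensor_span rs" by auto
  then have c: "s' \<in> carrier T" "t' \<in> carrier T" "r \<in> carrier R"
    using tensor_span_carrier Cons.prems(1) by auto
  have "s \<oplus>\<^bsub>T\<^esub> t = tens (a \<oplus>\<^bsub>A\<^esub> b) r \<oplus>\<^bsub>T\<^esub> (s' \<oplus>\<^bsub>T\<^esub> t')"
    using st c by (simp add: tens_add_left T.a_ac)
  moreover have "s' \<oplus>\<^bsub>T\<^esub> t' \<in> tensor_span rs" using Cons.IH Cons.prems(1) st by auto
  ultimately show ?case using st(3,4) by auto
qed auto

lemma tens_in_tensor_span:
  assumes "set rs \<subseteq> carrier R" "a \<in> carrier A" "s \<in> span rs"
  shows "tens a s \<in> tensor_span rs"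
  using assms
proof (induction rs arbitrary: a s)
  case (Cons r rs)
  then obtain u k where s: "s = u \<oplus>\<^bsub>R\<^esub> k \<odot>\<^bsub>R\<^esub> r" "u \<in> span rs" "k \<in> carrier K"
    by (auto simp: adjoin_line_def)
  have c: "u \<in> carrier R" "r \<in> carrier R"
    using s R.submoduleE(1)[OF span_submodule[of rs]] Cons.prems(1) by auto
  have "tens a s = tens (k \<odot>\<^bsub>A\<^esub> a) r \<oplus>\<^bsub>T\<^esub> tens a u"
    using s c Cons.prems(2) by (simp add: tens_add_right tens_balanced T.a_comm)
  moreover have "tens a u \<in> tensor_span rs" using Cons s by auto
  moreover have "k \<odot>\<^bsub>A\<^esub> a \<in> carrier A" using s Cons.prems(2) by simp
  ultimately show ?case by auto
qed auto

lemma tensor_span_exhausts: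
  assumes "t \<in> carrier T"
  shows "\<exists>rs. set rs \<subseteq> carrier R \<and> t \<in> tensor_span rs"
  using assms
proof (induction rule: tensor_induct)
  case (tens a r)
  then have "tens a r = tens a r \<oplus>\<^bsub>T\<^esub> \<zero>\<^bsub>T\<^esub>" by simp
  then have "tens a r \<in> tensor_span [r]" using tens(1) by auto
  then show ?case using tens(2) by (intro exI[of _ "[r]"]) simp
next
  case (add s t)
  then obtain rs rs' where rs: "set rs \<subseteq> carrier R" "s \<in> tensor_span rs"
    "set rs' \<subseteq> carrier R" "t \<in> tensor_span rs'" by blast
  have "s \<oplus>\<^bsub>T\<^esub> t \<in> tensor_span (rs @ rs')"
    using rs(1,2)
  proof (induction rs arbitrary: s)
    case Nil
    then show ?case using rs(4) add(2) by simp
  next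
    case (Cons r rs)
    then obtain a s' where s: "s = tens a r \<oplus>\<^bsub>T\<^esub> s'" "a \<in> carrier A" "s' \<in> tensor_span rs" by auto
    then have "s \<oplus>\<^bsub>T\<^esub> t = tens a r \<oplus>\<^bsub>T\<^esub> (s' \<oplus>\<^bsub>T\<^esub> t)"
      using tensor_span_carrier[of rs] Cons.prems(1) add(2) by (auto simp: T.a_assoc)
    then show ?case using Cons s by auto
  qed
  then show ?case using rs by (intro exI[of _ "rs @ rs'"]) simp
qed

lemma slice_tensor_span_eq_zero:
  assumes \<phi>: "\<phi> \<in> functionals K R" and rs: "set rs \<subseteq> carrier R"
    and zero: "\<And>s. s \<in> span rs \<Longrightarrow> \<phi> s = \<zero>\<^bsub>K\<^esub>" and t: "t \<in> tensor_span rs"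
  shows "slice \<phi> t = \<zero>\<^bsub>A\<^esub>"
  using rs zero t
proof (induction rs arbitrary: t)
  case Nil
  interpret h: abelian_group_hom T A "slice \<phi>" by (rule slice(1)[OF \<phi>])
  show ?case using Nil h.hom_zero by simp
next
  case (Cons r rs)
  interpret h: abelian_group_hom T A "slice \<phi>" by (rule slice(1)[OF \<phi>])
  obtain a t' where t: "t = tens a r \<oplus>\<^bsub>T\<^esub> t'" "a \<in> carrier A" "t' \<in> tensor_span rs"
    using Cons.prems(3) by auto
  have rs: "set rs \<subseteq> carrier R" "r \<in> carrier R" using Cons.prems(1) by auto
  note line = R.adjoin_line_submodule[OF span_submodule[OF rs(1)] rs(2)]
  have "slice \<phi> t' = \<zero>\<^bsub>A\<^esub>" using Cons.IH[OF rs(1) _ t(3)] Cons.prems(2) line(2) by auto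
  moreover have "\<phi> r = \<zero>\<^bsub>K\<^esub>" using Cons.prems(2) line(3) by simp
  ultimately show ?case
    using t rs tensor_span_carrier[OF rs(1)] slice(2)[OF \<phi> t(2) rs(2)] by (auto simp: h.hom_add)
qed

text \<open>
  Write \<open>t\<close> as \<open>a\<^sub>1 \<otimes> r\<^sub>1 + \<dots> + a\<^sub>n \<otimes> r\<^sub>n\<close> and induct on \<open>n\<close>.  If \<open>r\<^sub>1\<close> is
  a combination of the other \<open>r\<^sub>i\<close>, the first term can be absorbed into the others.
  Otherwise a functional \<open>\<phi>\<close> that vanishes on the other \<open>r\<^sub>i\<close> with \<open>\<phi> r\<^sub>1 = 1\<close> recovers
  \<open>a\<^sub>1\<close> as \<open>slice \<phi> t\<close>.  So \<open>a\<^sub>1\<close> is a scalar, the first term has the form \<open>1 \<otimes> r\<close>, and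
  the slices of the remaining sum are again scalars.
\<close>

lemma scalar_slices:
  assumes "set rs \<subseteq> carrier R" "t \<in> tensor_span rs"
    and "\<And>\<phi>. \<phi> \<in> functionals K R \<Longrightarrow> slice \<phi> t \<in> (\<lambda>k. k \<odot>\<^bsub>A\<^esub> \<one>\<^bsub>A\<^esub>) ` carrier K"
  shows "\<exists>r\<in>carrier R. t = tens \<one>\<^bsub>A\<^esub> r"
  using assms
proof (induction rs arbitrary: t)
  case Nil
  then show ?case by (intro bexI[of _ "\<zero>\<^bsub>R\<^esub>"]) auto
next
  case (Cons r rs)
  have rs: "set rs \<subseteq> carrier R" "r \<in> carrier R" using Cons.prems(1) by auto
  obtain a t' where t: "t = tens a r \<oplus>\<^bsub>T\<^esub> t'" "a \<in> carrier A" "t' \<in> tensor_span rs"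
    using Cons.prems(2) by auto
  have t'c: "t' \<in> carrier T" using t(3) tensor_span_carrier[OF rs(1)] by blast
  show ?case
  proof (cases "r \<in> span rs")
    case True
    then have "t \<in> tensor_span rs"
      using t tensor_span_add[OF rs(1) tens_in_tensor_span[OF rs(1)]] by blast
    then show ?thesis using Cons.IH rs(1) Cons.prems(3) by blast
  next
    case False
    obtain \<phi> where \<phi>: "\<phi> \<in> functionals K R" "\<And>s. s \<in> span rs \<Longrightarrow> \<phi> s = \<zero>\<^bsub>K\<^esub>" "\<phi> r = \<one>\<^bsub>K\<^esub>"
      using R.separating_functional[OF A.K.field_axioms span_submodule[OF rs(1)] rs(2) False] by blast
    have "slice \<phi> t = slice \<phi> (tens a r) \<oplus>\<^bsub>A\<^esub> slice \<phi> t'"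
      using t t'c rs by (simp add: abelian_group_hom.hom_add[OF slice(1)[OF \<phi>(1)]])
    also have "\<dots> = a"
      using slice_tensor_span_eq_zero[OF \<phi>(1) rs(1) \<phi>(2) t(3)] t(2) rs(2) \<phi>(3)
      by (simp add: slice(2)[OF \<phi>(1)])
    finally obtain k where k: "k \<in> carrier K" "a = k \<odot>\<^bsub>A\<^esub> \<one>\<^bsub>A\<^esub>"
      using Cons.prems(3)[OF \<phi>(1)] by auto
    have "slice \<psi> t' \<in> (\<lambda>k. k \<odot>\<^bsub>A\<^esub> \<one>\<^bsub>A\<^esub>) ` carrier K" if \<psi>: "\<psi> \<in> functionals K R" for \<psi>
    proof -
      obtain l where l: "l \<in> carrier K" "slice \<psi> t = l \<odot>\<^bsub>A\<^esub> \<one>\<^bsub>A\<^esub>"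
        using Cons.prems(3)[OF \<psi>] by blast
      have c: "\<psi> r \<in> carrier K" "slice \<psi> t' \<in> carrier A"
        using functionalsD(1)[OF \<psi> rs(2)] abelian_group_hom.hom_closed[OF slice(1)[OF \<psi>] t'c] by auto
      have "l \<odot>\<^bsub>A\<^esub> \<one>\<^bsub>A\<^esub> = (\<psi> r \<otimes>\<^bsub>K\<^esub> k) \<odot>\<^bsub>A\<^esub> \<one>\<^bsub>A\<^esub> \<oplus>\<^bsub>A\<^esub> slice \<psi> t'"
        using l t t'c rs k c
        by (simp add: abelian_group_hom.hom_add[OF slice(1)[OF \<psi>]] slice(2)[OF \<psi>] A.smult_assoc1)
      then have "slice \<psi> t' = (\<ominus>\<^bsub>K\<^esub> (\<psi> r \<otimes>\<^bsub>K\<^esub> k)) \<odot>\<^bsub>A\<^esub> \<one>\<^bsub>A\<^esub> \<oplus>\<^bsub>A\<^esub> l \<odot>\<^bsub>A\<^esub> \<one>\<^bsub>A\<^esub>"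
        using c k l by (simp add: A.smult_l_minus A.M.r_neg1)
      also have "\<dots> = (\<ominus>\<^bsub>K\<^esub> (\<psi> r \<otimes>\<^bsub>K\<^esub> k) \<oplus>\<^bsub>K\<^esub> l) \<odot>\<^bsub>A\<^esub> \<one>\<^bsub>A\<^esub>"
        using c k l by (simp add: A.smult_l_distr)
      finally show ?thesis using c k l by blast
    qed
    then obtain s where s: "s \<in> carrier R" "t' = tens \<one>\<^bsub>A\<^esub> s"
      using Cons.IH[OF rs(1) t(3)] by blast
    have "t = tens \<one>\<^bsub>A\<^esub> (k \<odot>\<^bsub>R\<^esub> r \<oplus>\<^bsub>R\<^esub> s)"
      using t(1) k s rs by (simp add: tens_add_right tens_balanced)
    then show ?thesis using k s rs by auto
  qed
qed

theorem center_of_tensor: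
  assumes A: "trivial_poisson_center K A" and t: "t \<in> poisson_center T"
  shows "\<exists>r\<in>carrier R. t = tens \<one>\<^bsub>A\<^esub> r"
proof -
  have Z: "poisson_center A = (\<lambda>k. k \<odot>\<^bsub>A\<^esub> \<one>\<^bsub>A\<^esub>) ` carrier K"
    using A by (auto simp: trivial_poisson_center_def bij_betw_def)
  have "t \<in> carrier T" using t by (simp add: poisson_center_def)
  then obtain rs where "set rs \<subseteq> carrier R" "t \<in> tensor_span rs"
    using tensor_span_exhausts by blast
  then show ?thesis
    using scalar_slices slice_center[OF _ t] Z by blast
qed

lemma tens_one_central:
  assumes R: "trivial_bracket R" and r: "r \<in> carrier R"
  shows "tens \<one>\<^bsub>A\<^esub> r \<in> poisson_center T"
proof -
  have "\<lbrace>tens \<one>\<^bsub>A\<^esub> r, t\<rbrace>\<^bsub>T\<^esub> = \<zero>\<^bsub>T\<^esub>" if "t \<in> carrier T" for t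
    using that
  proof (induction rule: tensor_induct)
    case (tens b s)
    then show ?case using r R A.bracket_one_left[of b]
      by (simp add: tens_bracket trivial_bracket_def)
  next
    case (add s t)
    then show ?case using r by (simp add: TB.lie_add_right)
  qed
  then show ?thesis using r by (simp add: poisson_center_def)
qed

text \<open>
  A functional \<open>\<phi>\<close> on \<open>A\<close> with \<open>\<phi> 1 = 1\<close> makes \<open>\<phi> \<otimes> id\<close> a left inverse.  It exists because
  \<open>A\<close>, which contains the field, is not zero.
\<close>

lemma tens_one_inj:
  assumes A: "trivial_poisson_center K A"
  shows "inj_on (tens \<one>\<^bsub>A\<^esub>) (carrier R)"
proof -
  have one: "\<one>\<^bsub>A\<^esub> \<noteq> \<zero>\<^bsub>A\<^esub>"
  proof
    assume "\<one>\<^bsub>A\<^esub> = \<zero>\<^bsub>A\<^esub>"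
    then have "\<one>\<^bsub>K\<^esub> \<odot>\<^bsub>A\<^esub> \<one>\<^bsub>A\<^esub> = \<zero>\<^bsub>K\<^esub> \<odot>\<^bsub>A\<^esub> \<one>\<^bsub>A\<^esub>" by simp
    moreover have "inj_on (\<lambda>k. k \<odot>\<^bsub>A\<^esub> \<one>\<^bsub>A\<^esub>) (carrier K)"
      using A by (simp add: trivial_poisson_center_def bij_betw_def)
    ultimately have "\<one>\<^bsub>K\<^esub> = \<zero>\<^bsub>K\<^esub>"
      using inj_onD[of "\<lambda>k. k \<odot>\<^bsub>A\<^esub> \<one>\<^bsub>A\<^esub>" "carrier K" "\<one>\<^bsub>K\<^esub>" "\<zero>\<^bsub>K\<^esub>"] by blast
    then show False by simp
  qed
  have "submodule {\<zero>\<^bsub>A\<^esub>} K A"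
    by (rule A.submoduleI) (use A.M.l_neg[OF A.M.zero_closed] in auto)
  then obtain \<phi> where \<phi>: "\<phi> \<in> functionals K A" "\<phi> \<one>\<^bsub>A\<^esub> = \<one>\<^bsub>K\<^esub>"
    using A.separating_functional[OF A.K.field_axioms, of "{\<zero>\<^bsub>A\<^esub>}" "\<one>\<^bsub>A\<^esub>"] one by auto
  note [simp] = functionalsD[OF \<phi>(1)]
  have "\<exists>h. abelian_group_hom T R h \<and> (\<forall>a\<in>carrier A. \<forall>r\<in>carrier R. h (tens a r) = \<phi> a \<odot>\<^bsub>R\<^esub> r)"
    by (rule tensor_universal)
      (simp_all add: R.M.abelian_group_axioms R.smult_r_distr R.smult_l_distr R.smult_assoc1[symmetric]
        A.K.m_comm)
  then obtain h where h: "\<forall>a\<in>carrier A. \<forall>r\<in>carrier R. h (tens a r) = \<phi> a \<odot>\<^bsub>R\<^esub> r"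
    by blast
  then have "h (tens \<one>\<^bsub>A\<^esub> r) = r" if "r \<in> carrier R" for r
    using that \<phi>(2) by simp
  then show ?thesis by (rule inj_on_inverseI)
qed

end

section \<open>Cancellation\<close>

context poisson_pair
begin

lemma tens_one_ring_hom: "tens \<one>\<^bsub>A\<^esub> \<in> ring_hom R T"
  by (rule ring_hom_memI) (simp_all add: tens_mult tens_add_right T_one)

lemma tens_one_right_poisson_hom: "(\<lambda>a. tens a \<one>\<^bsub>R\<^esub>) \<in> poisson_hom K A T"
  unfolding poisson_hom_def
proof (intro CollectI conjI ballI)
  show "(\<lambda>a. tens a \<one>\<^bsub>R\<^esub>) \<in> ring_hom A T"
    by (rule ring_hom_memI) (simp_all add: tens_mult tens_add_left T_one)
qed (simp_all add: tens_smult tens_bracket R.bracket_self)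

lemma slice_poisson_hom:
  assumes \<epsilon>: "\<epsilon> \<in> functionals K R" "\<epsilon> \<in> ring_hom R K" and R: "trivial_bracket R"
  shows "slice \<epsilon> \<in> poisson_hom K T A"
proof (rule tensor_poisson_homI[OF A.biadditive slice(1)[OF \<epsilon>(1)]])
  note [simp] = slice(2)[OF \<epsilon>(1)] functionalsD[OF \<epsilon>(1)]
  have [simp]: "\<epsilon> \<one>\<^bsub>R\<^esub> = \<one>\<^bsub>K\<^esub>" "\<And>r s. \<lbrakk>r \<in> carrier R; s \<in> carrier R\<rbrakk> \<Longrightarrow> \<epsilon> (r \<otimes>\<^bsub>R\<^esub> s) = \<epsilon> r \<otimes>\<^bsub>K\<^esub> \<epsilon> s"
    using \<epsilon>(2) by (auto simp: ring_hom_def)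
  show "slice \<epsilon> \<one>\<^bsub>T\<^esub> = \<one>\<^bsub>A\<^esub>" by (simp add: T_one)
  show "slice \<epsilon> (tens (k \<odot>\<^bsub>A\<^esub> a) r) = k \<odot>\<^bsub>A\<^esub> slice \<epsilon> (tens a r)"
    if "k \<in> carrier K" "a \<in> carrier A" "r \<in> carrier R" for k a r
    using that by (simp add: A.smult_assoc1[symmetric] A.K.m_comm)
  fix a b r s assume *: "a \<in> carrier A" "b \<in> carrier A" "r \<in> carrier R" "s \<in> carrier R"
  have c: "a \<otimes>\<^bsub>A\<^esub> b \<in> carrier A" "r \<otimes>\<^bsub>R\<^esub> s \<in> carrier R"
    using * by simp_all
  show "slice \<epsilon> (tens (a \<otimes>\<^bsub>A\<^esub> b) (r \<otimes>\<^bsub>R\<^esub> s)) = slice \<epsilon> (tens a r) \<otimes>\<^bsub>A\<^esub> slice \<epsilon> (tens b s)"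
    using * c by (simp add: A.smult_assoc2 A.mult_smult_right A.smult_assoc1[symmetric] A.K.m_comm)
  show "slice \<epsilon> (tens \<lbrace>a, b\<rbrace>\<^bsub>A\<^esub> (r \<otimes>\<^bsub>R\<^esub> s)) \<oplus>\<^bsub>A\<^esub> slice \<epsilon> (tens (a \<otimes>\<^bsub>A\<^esub> b) \<lbrace>r, s\<rbrace>\<^bsub>R\<^esub>)
      = \<lbrace>slice \<epsilon> (tens a r), slice \<epsilon> (tens b s)\<rbrace>\<^bsub>A\<^esub>"
  proof -
    have "\<lbrace>r, s\<rbrace>\<^bsub>R\<^esub> = \<zero>\<^bsub>R\<^esub>" using R * by (simp add: trivial_bracket_def)
    then have "slice \<epsilon> (tens (a \<otimes>\<^bsub>A\<^esub> b) \<lbrace>r, s\<rbrace>\<^bsub>R\<^esub>) = \<zero>\<^bsub>A\<^esub>"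
      using c abelian_group_hom.hom_zero[OF slice(1)[OF \<epsilon>(1)]] by (simp del: slice(2))
    then show ?thesis
      using * c by (simp add: A.bracket_smult_left A.bracket_smult_right A.smult_assoc1[symmetric] A.K.m_comm)
  qed
qed

end

lemma poisson_hom_zero:
  assumes "biadditive_algebra K M" "biadditive_algebra K N" "h \<in> poisson_hom K M N"
  shows "h \<zero>\<^bsub>M\<^esub> = \<zero>\<^bsub>N\<^esub>"
proof -
  interpret M: biadditive_algebra K M by fact
  interpret N: biadditive_algebra K N by fact
  have "h \<zero>\<^bsub>M\<^esub> \<oplus>\<^bsub>N\<^esub> h \<zero>\<^bsub>M\<^esub> = h \<zero>\<^bsub>M\<^esub>"
    using poisson_homD(3)[OF assms(3), of "\<zero>\<^bsub>M\<^esub>" "\<zero>\<^bsub>M\<^esub>"] by simp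
  then show ?thesis
    using poisson_homD(1)[OF assms(3), of "\<zero>\<^bsub>M\<^esub>"] by (metis M.zero_closed N.add.l_cancel_one')
qed

lemma poisson_hom_center:
  assumes "biadditive_algebra K M" "biadditive_algebra K N" and h: "h \<in> poisson_hom K M N"
    and surj: "h ` carrier M = carrier N" and z: "z \<in> poisson_center M"
  shows "h z \<in> poisson_center N"
proof -
  have z': "z \<in> carrier M" "\<And>m. m \<in> carrier M \<Longrightarrow> \<lbrace>z, m\<rbrace>\<^bsub>M\<^esub> = \<zero>\<^bsub>M\<^esub>"
    using z by (auto simp: poisson_center_def)
  have "\<lbrace>h z, n\<rbrace>\<^bsub>N\<^esub> = \<zero>\<^bsub>N\<^esub>" if n: "n \<in> carrier N" for n
  proof -
    obtain m where m: "m \<in> carrier M" "n = h m" using n unfolding surj[symmetric] by blast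
    then show ?thesis
      using poisson_homD(6)[OF h z'(1) m(1)] z'(2)[OF m(1)] poisson_hom_zero[OF assms(1-3)] by simp
  qed
  then show ?thesis using poisson_homD(1)[OF h z'(1)] by (simp add: poisson_center_def)
qed

lemma ring_hom_factor:
  assumes R: "ring R" and j: "j \<in> ring_hom R S" "inj_on j (carrier R)" and h: "h \<in> ring_hom R S"
    and \<rho>: "\<And>r. r \<in> carrier R \<Longrightarrow> \<rho> r \<in> carrier R" "\<And>r. r \<in> carrier R \<Longrightarrow> j (\<rho> r) = h r"
  shows "\<rho> \<in> ring_hom R R"
proof (rule ring_hom_memI)
  interpret ring R by fact
  note jD = ring_hom_mult[OF j(1)] ring_hom_add[OF j(1)] ring_hom_one[OF j(1)]
  note hD = ring_hom_mult[OF h] ring_hom_add[OF h] ring_hom_one[OF h]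
  fix r s assume *: "r \<in> carrier R" "s \<in> carrier R"
  show "\<rho> (r \<otimes>\<^bsub>R\<^esub> s) = \<rho> r \<otimes>\<^bsub>R\<^esub> \<rho> s"
    by (rule inj_onD[OF j(2)]) (use * in \<open>simp_all add: \<rho> jD hD\<close>)
  show "\<rho> (r \<oplus>\<^bsub>R\<^esub> s) = \<rho> r \<oplus>\<^bsub>R\<^esub> \<rho> s"
    by (rule inj_onD[OF j(2)]) (use * in \<open>simp_all add: \<rho> jD hD\<close>)
next
  interpret ring R by fact
  show "\<rho> \<one>\<^bsub>R\<^esub> = \<one>\<^bsub>R\<^esub>"
    by (rule inj_onD[OF j(2)]) (simp_all add: \<rho> ring_hom_one[OF j(1)] ring_hom_one[OF h])
qed (rule \<rho>(1))

text \<open>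
  The augmentation is the projection modulo \<open>I\<close> followed by the inverse of the given
  isomorphism.
\<close>

lemma (in algebra) augmentation_of_ideal:
  assumes I: "ideal I M" and iso: "(\<lambda>k. I +>\<^bsub>M\<^esub> (k \<odot>\<^bsub>M\<^esub> \<one>\<^bsub>M\<^esub>)) \<in> ring_iso R (M Quot I)"
  obtains \<epsilon> where "\<epsilon> \<in> functionals R M" "\<epsilon> \<in> ring_hom M R"
proof -
  let ?h = "\<lambda>k. I +>\<^bsub>M\<^esub> (k \<odot>\<^bsub>M\<^esub> \<one>\<^bsub>M\<^esub>)"
  define \<epsilon> where "\<epsilon> = inv_into (carrier R) ?h \<circ> (+>\<^bsub>M\<^esub>) I"
  have one: "\<one>\<^bsub>M\<^esub> \<in> carrier M" by simp
  have "inv_into (carrier R) ?h \<in> ring_hom (M Quot I) R"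
    using ring_iso_set_sym[OF R.ring_axioms iso] by (simp add: ring_iso_def)
  then have hom: "\<epsilon> \<in> ring_hom M R"
    unfolding \<epsilon>_def using ring_hom_trans[OF ideal.rcos_ring_hom[OF I]] by blast
  have scalar: "\<epsilon> (k \<odot>\<^bsub>M\<^esub> \<one>\<^bsub>M\<^esub>) = k" if "k \<in> carrier R" for k
    using iso that inv_into_f_f[of ?h "carrier R" k] by (simp add: \<epsilon>_def ring_iso_def bij_betw_def)
  have "\<epsilon> \<in> functionals R M"
    unfolding functionals_def
  proof (intro CollectI conjI ballI)
    fix k v assume kv: "k \<in> carrier R" "v \<in> carrier M"
    have "k \<odot>\<^bsub>M\<^esub> v = (k \<odot>\<^bsub>M\<^esub> \<one>\<^bsub>M\<^esub>) \<otimes>\<^bsub>M\<^esub> v"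
      using kv one smult_assoc2[of k "\<one>\<^bsub>M\<^esub>" v] by simp
    then show "\<epsilon> (k \<odot>\<^bsub>M\<^esub> v) = k \<otimes> \<epsilon> v"
      using ring_hom_mult[OF hom, of "k \<odot>\<^bsub>M\<^esub> \<one>\<^bsub>M\<^esub>" v] kv one scalar by simp
  qed (use hom ring_hom_add[OF hom] in \<open>auto simp: ring_hom_def\<close>)
  then show thesis using hom that by blast
qed

locale common_factor = PA: poisson_pair K A R + PB: poisson_pair K B R
  for K :: "('k, 'n) ring_scheme" and A :: "('k, 'a, 'm) poisson_scheme"
    and B :: "('k, 'b, 'l) poisson_scheme" and R :: "('k, 'r, 'p) poisson_scheme" +
  assumes R_trivial: "trivial_bracket R"
begin

lemma tensor_map:
  assumes \<beta>: "\<beta> \<in> poisson_hom K A B"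
  obtains \<Gamma> where "\<Gamma> \<in> poisson_hom K PA.T PB.T"
    "\<And>a r. \<lbrakk>a \<in> carrier A; r \<in> carrier R\<rbrakk> \<Longrightarrow> \<Gamma> (PA.tens a r) = PB.tens (\<beta> a) r"
proof -
  note [simp] = poisson_homD[OF \<beta>]
  have "\<exists>h. abelian_group_hom PA.T PB.T h \<and>
      (\<forall>a\<in>carrier A. \<forall>r\<in>carrier R. h (PA.tens a r) = PB.tens (\<beta> a) r)"
    by (rule PA.tensor_universal)
      (simp_all add: PB.T_abelian_group PB.tens_add_left PB.tens_add_right PB.tens_balanced)
  then obtain \<Gamma> where hom: "abelian_group_hom PA.T PB.T \<Gamma>"
    and \<Gamma> [simp]: "\<And>a r. \<lbrakk>a \<in> carrier A; r \<in> carrier R\<rbrakk> \<Longrightarrow> \<Gamma> (PA.tens a r) = PB.tens (\<beta> a) r"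
    by blast
  have "\<Gamma> \<in> poisson_hom K PA.T PB.T"
  proof (rule PA.tensor_poisson_homI[OF PB.T_biadditive hom])
    fix a b r s assume *: "a \<in> carrier A" "b \<in> carrier A" "r \<in> carrier R" "s \<in> carrier R"
    have c: "a \<otimes>\<^bsub>A\<^esub> b \<in> carrier A" "r \<otimes>\<^bsub>R\<^esub> s \<in> carrier R"
      using * by simp_all
    show "\<Gamma> (PA.tens (a \<otimes>\<^bsub>A\<^esub> b) (r \<otimes>\<^bsub>R\<^esub> s)) = \<Gamma> (PA.tens a r) \<otimes>\<^bsub>PB.T\<^esub> \<Gamma> (PA.tens b s)"
      using * c by (simp add: PB.tens_mult)
    show "\<Gamma> (PA.tens \<lbrace>a, b\<rbrace>\<^bsub>A\<^esub> (r \<otimes>\<^bsub>R\<^esub> s)) \<oplus>\<^bsub>PB.T\<^esub> \<Gamma> (PA.tens (a \<otimes>\<^bsub>A\<^esub> b) \<lbrace>r, s\<rbrace>\<^bsub>R\<^esub>)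
        = \<lbrace>\<Gamma> (PA.tens a r), \<Gamma> (PA.tens b s)\<rbrace>\<^bsub>PB.T\<^esub>"
      using * c by (simp add: PB.tens_bracket)
  qed (simp_all add: PA.T_one PB.T_one PB.tens_smult)
  then show thesis using that \<Gamma> by blast
qed

lemma tensor_map_surj:
  assumes \<Gamma>: "\<Gamma> \<in> poisson_hom K PA.T PB.T"
    and tens: "\<And>a r. \<lbrakk>a \<in> carrier A; r \<in> carrier R\<rbrakk> \<Longrightarrow> \<Gamma> (PA.tens a r) = PB.tens (\<beta> a) r"
    and surj: "carrier B \<subseteq> \<beta> ` carrier A"
  shows "\<Gamma> ` carrier PA.T = carrier PB.T"
proof
  show "\<Gamma> ` carrier PA.T \<subseteq> carrier PB.T" using poisson_homD(1)[OF \<Gamma>] by blast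
  show "carrier PB.T \<subseteq> \<Gamma> ` carrier PA.T"
  proof
    fix t assume "t \<in> carrier PB.T"
    then show "t \<in> \<Gamma> ` carrier PA.T"
    proof (induction rule: PB.tensor_induct)
      case (tens b r)
      then obtain a where "a \<in> carrier A" "b = \<beta> a" using surj by blast
      then show ?case using tens(2) assms(2)[of a r] by (intro image_eqI[of _ _ "PA.tens a r"]) auto
    next
      case (add s t)
      then obtain s' t' where "s' \<in> carrier PA.T" "t' \<in> carrier PA.T" "s = \<Gamma> s'" "t = \<Gamma> t'" by blast
      then show ?case using poisson_homD(3)[OF \<Gamma>] by (intro image_eqI[of _ _ "s' \<oplus>\<^bsub>PA.T\<^esub> t'"]) auto
    qed
  qed
qed

text \<open>
  A homomorphism compatible with the augmentations of \<open>R\<close> descends to the fibres: the evaluation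
  of \<open>\<phi> t\<close> depends on the evaluation of \<open>t\<close> alone.  For \<open>t = a \<otimes> r = (a \<otimes> 1) (1 \<otimes> r)\<close>, the
  factor \<open>\<phi> (1 \<otimes> r) = 1 \<otimes> \<rho> r\<close> is evaluated to the scalar \<open>\<epsilon>' (\<rho> r) = \<epsilon> r\<close>, which is also
  what the evaluation of \<open>t\<close> makes of \<open>r\<close>.
\<close>

lemma slice_transfer:
  assumes \<phi>: "\<phi> \<in> poisson_hom K PA.T PB.T"
    and \<rho>: "\<And>r. r \<in> carrier R \<Longrightarrow> \<rho> r \<in> carrier R"
      "\<And>r. r \<in> carrier R \<Longrightarrow> \<phi> (PA.tens \<one>\<^bsub>A\<^esub> r) = PB.tens \<one>\<^bsub>B\<^esub> (\<rho> r)"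
    and \<epsilon>: "\<epsilon> \<in> functionals K R"
    and \<epsilon>': "\<epsilon>' \<in> functionals K R" "\<epsilon>' \<in> ring_hom R K"
    and compat: "\<And>r. r \<in> carrier R \<Longrightarrow> \<epsilon>' (\<rho> r) = \<epsilon> r"
    and t: "t \<in> carrier PA.T"
  shows "PB.slice \<epsilon>' (\<phi> t) = PB.slice \<epsilon>' (\<phi> (PA.tens (PA.slice \<epsilon> t) \<one>\<^bsub>R\<^esub>))"
proof -
  define \<gamma> where "\<gamma> = (\<lambda>a. PB.slice \<epsilon>' (\<phi> (PA.tens a \<one>\<^bsub>R\<^esub>)))"
  note E' = PB.slice_poisson_hom[OF \<epsilon>' R_trivial]
  have \<gamma>: "\<gamma> \<in> poisson_hom K A B"
    unfolding \<gamma>_def using poisson_hom_compose[OF E' poisson_hom_compose[OF \<phi> PA.tens_one_right_poisson_hom]] .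
  have "PB.slice \<epsilon>' (\<phi> t) = \<gamma> (PA.slice \<epsilon> t)"
    using t
  proof (induction rule: PA.tensor_induct)
    case (tens a r)
    have "PB.slice \<epsilon>' (\<phi> (PA.tens a r)) = PB.slice \<epsilon>' (\<phi> (PA.tens a \<one>\<^bsub>R\<^esub> \<otimes>\<^bsub>PA.T\<^esub> PA.tens \<one>\<^bsub>A\<^esub> r))"
      using tens by (simp add: PA.tens_mult)
    also have "\<dots> = \<gamma> a \<otimes>\<^bsub>B\<^esub> PB.slice \<epsilon>' (PB.tens \<one>\<^bsub>B\<^esub> (\<rho> r))"
      using tens by (simp add: poisson_homD[OF \<phi>] poisson_homD[OF E'] \<rho> \<gamma>_def)
    also have "\<dots> = \<epsilon> r \<odot>\<^bsub>B\<^esub> \<gamma> a"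
      using tens functionalsD(1)[OF \<epsilon>] poisson_homD(1)[OF \<gamma>]
      by (simp add: PB.slice(2)[OF \<epsilon>'(1)] \<rho> compat PB.A.mult_smult_right)
    also have "\<dots> = \<gamma> (PA.slice \<epsilon> (PA.tens a r))"
      using tens functionalsD(1)[OF \<epsilon>] by (simp add: PA.slice(2)[OF \<epsilon>] poisson_homD[OF \<gamma>])
    finally show ?case .
  next
    case (add s t)
    then show ?case
      using abelian_group_hom.hom_closed[OF PA.slice(1)[OF \<epsilon>]]
      by (simp add: poisson_homD[OF \<phi>] poisson_homD[OF E'] poisson_homD[OF \<gamma>]
          abelian_group_hom.hom_add[OF PA.slice(1)[OF \<epsilon>]])
  qed
  then show ?thesis by (simp add: \<gamma>_def)
qed

end

text \<open>
  The endomorphism \<open>\<theta>\<close> of \<open>R\<close> describes the inverse isomorphism \<open>\<psi>\<close> on \<open>1 \<otimes> R\<close>, and \<open>\<rho>\<close> is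
  built so that \<open>\<rho> \<circ> \<theta> = id\<close>.  Once \<open>\<rho>\<close> is known to be injective, \<open>\<rho>\<close> describes \<open>\<phi>\<close> on
  \<open>1 \<otimes> R\<close>, and the maps \<open>\<beta>\<close> and \<open>\<gamma>\<close> induced by \<open>\<psi>\<close> and \<open>\<phi>\<close> on the fibres are inverse to
  each other.
\<close>

theorem poisson_cancellation:
  assumes "common_factor K A B R" and center: "trivial_poisson_center K A"
    and noetherian: "noetherian_ring R"
    and \<epsilon>: "\<epsilon> \<in> functionals K R" "\<epsilon> \<in> ring_hom R K"
    and iso: "poisson_isomorphic K (poisson_tensor K A R) (poisson_tensor K B R)"
  shows "poisson_isomorphic K A B"
proof -
  interpret AB: common_factor K A B R by fact
  interpret BA: common_factor K B A R
    using AB.R_trivial AB.PA.poisson_pair_axioms AB.PB.poisson_pair_axioms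
    by (simp add: common_factor_def common_factor_axioms_def)
  have R: "ring R" using noetherian noetherian_ring.axioms(1) by blast
  note TA = AB.PA.T_biadditive and TB = AB.PB.T_biadditive
  let ?TA = "poisson_tensor K A R" and ?TB = "poisson_tensor K B R"
  let ?\<iota>A = "\<lambda>a. AB.PA.tens a \<one>\<^bsub>R\<^esub>" and ?\<iota>B = "\<lambda>b. AB.PB.tens b \<one>\<^bsub>R\<^esub>"
  let ?jA = "AB.PA.tens \<one>\<^bsub>A\<^esub>" and ?jB = "AB.PB.tens \<one>\<^bsub>B\<^esub>"
  have jA: "?jA \<in> ring_hom R ?TA" "inj_on ?jA (carrier R)" and jB: "?jB \<in> ring_hom R ?TB"
    using AB.PA.tens_one_ring_hom AB.PB.tens_one_ring_hom AB.PA.tens_one_inj[OF center] by auto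
  obtain \<phi> where \<phi>_iso: "\<phi> \<in> poisson_iso K ?TA ?TB" using iso by (auto simp: poisson_isomorphic_def)
  then have \<phi>: "\<phi> \<in> poisson_hom K ?TA ?TB" and \<phi>_bij: "bij_betw \<phi> (carrier ?TA) (carrier ?TB)"
    by (auto simp: poisson_iso_iff)
  define \<psi> where "\<psi> = inv_into (carrier ?TA) \<phi>"
  have \<psi>: "\<psi> \<in> poisson_hom K ?TB ?TA"
    unfolding \<psi>_def using poisson_hom_inv_into[OF TA AB.PA.T_one_closed \<phi>_iso] .
  have \<psi>\<phi>: "\<psi> (\<phi> t) = t" if "t \<in> carrier ?TA" for t
    using \<phi>_bij that by (simp add: \<psi>_def bij_betw_inv_into_left)
  have \<phi>\<psi>: "\<phi> (\<psi> u) = u" if "u \<in> carrier ?TB" for u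
    using \<phi>_bij that by (simp add: \<psi>_def bij_betw_inv_into_right)
  have \<phi>_surj: "\<phi> ` carrier ?TA = carrier ?TB" using \<phi>_bij by (simp add: bij_betw_def)
  have \<psi>_surj: "\<psi> ` carrier ?TB = carrier ?TA"
    using bij_betw_inv_into[OF \<phi>_bij] by (simp add: bij_betw_def \<psi>_def)

  \<comment> \<open>Elements \<open>1 \<otimes> r\<close> are central, and \<open>\<psi>\<close> sends them into the center \<open>1 \<otimes> R\<close> of \<open>A \<otimes> R\<close>.\<close>
  have "\<forall>r\<in>carrier R. \<exists>s\<in>carrier R. \<psi> (?jB r) = ?jA s"
    using AB.PA.center_of_tensor[OF center]
      poisson_hom_center[OF TB TA \<psi> \<psi>_surj AB.PB.tens_one_central[OF AB.R_trivial]] by blast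
  then obtain \<theta> where \<theta>: "\<And>r. r \<in> carrier R \<Longrightarrow> \<theta> r \<in> carrier R"
      "\<And>r. r \<in> carrier R \<Longrightarrow> \<psi> (?jB r) = ?jA (\<theta> r)"
    by metis
  have \<psi>_ring: "\<psi> \<in> ring_hom ?TB ?TA" and \<phi>_ring: "\<phi> \<in> ring_hom ?TA ?TB"
    using \<psi> \<phi> by (auto simp: poisson_hom_def)
  have \<theta>_hom: "\<theta> \<in> ring_hom R R"
    by (rule ring_hom_factor[OF R jA ring_hom_trans[OF jB \<psi>_ring]]) (simp_all add: \<theta>)
  have \<theta>_smult: "\<theta> (k \<odot>\<^bsub>R\<^esub> r) = k \<odot>\<^bsub>R\<^esub> \<theta> r" if k: "k \<in> carrier K" and r: "r \<in> carrier R" for k r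
  proof (rule inj_onD[OF jA(2)])
    have "?jA (\<theta> (k \<odot>\<^bsub>R\<^esub> r)) = \<psi> (k \<odot>\<^bsub>?TB\<^esub> ?jB r)"
      using k r \<theta>(2)[of "k \<odot>\<^bsub>R\<^esub> r"] by (simp add: AB.PB.tens_smult AB.PB.tens_balanced)
    also have "\<dots> = k \<odot>\<^bsub>?TA\<^esub> ?jA (\<theta> r)"
      using k r \<theta> by (simp add: poisson_homD(5)[OF \<psi>])
    also have "\<dots> = ?jA (k \<odot>\<^bsub>R\<^esub> \<theta> r)"
      using k r \<theta> by (simp add: AB.PA.tens_smult AB.PA.tens_balanced)
    finally show "?jA (\<theta> (k \<odot>\<^bsub>R\<^esub> r)) = ?jA (k \<odot>\<^bsub>R\<^esub> \<theta> r)" .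
  qed (use k r \<theta> in auto)

  \<comment> \<open>The augmentation that makes \<open>\<psi>\<close> compatible with the two evaluations.\<close>
  define \<epsilon>' where "\<epsilon>' = \<epsilon> \<circ> \<theta>"
  have \<epsilon>'_ring: "\<epsilon>' \<in> ring_hom R K"
    unfolding \<epsilon>'_def using ring_hom_trans[OF \<theta>_hom \<epsilon>(2)] .
  have \<epsilon>': "\<epsilon>' \<in> functionals K R"
    using functionalsD[OF \<epsilon>(1)] \<theta>_smult \<theta>(1) ring_hom_add[OF \<theta>_hom]
    by (auto simp: functionals_def \<epsilon>'_def)
  let ?EA = "AB.PA.slice \<epsilon>" and ?EB = "AB.PB.slice \<epsilon>'"
  have EA: "?EA \<in> poisson_hom K ?TA A" and EB: "?EB \<in> poisson_hom K ?TB B"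
    using AB.PA.slice_poisson_hom[OF \<epsilon> AB.R_trivial] AB.PB.slice_poisson_hom[OF \<epsilon>' \<epsilon>'_ring AB.R_trivial] .
  have EA_\<iota>: "?EA (?\<iota>A a) = a" if "a \<in> carrier A" for a
    using that ring_hom_one[OF \<epsilon>(2)] by (simp add: AB.PA.slice(2)[OF \<epsilon>(1)])
  have EB_\<iota>: "?EB (?\<iota>B b) = b" if "b \<in> carrier B" for b
    using that ring_hom_one[OF \<epsilon>'_ring] by (simp add: AB.PB.slice(2)[OF \<epsilon>'])
  define \<beta> where "\<beta> = (\<lambda>b. ?EA (\<psi> (?\<iota>B b)))"
  define \<gamma> where "\<gamma> = (\<lambda>a. ?EB (\<phi> (?\<iota>A a)))"
  have \<beta>: "\<beta> \<in> poisson_hom K B A"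
    unfolding \<beta>_def
    using poisson_hom_compose[OF EA poisson_hom_compose[OF \<psi> AB.PB.tens_one_right_poisson_hom]] .
  have \<gamma>: "\<gamma> \<in> poisson_hom K A B"
    unfolding \<gamma>_def
    using poisson_hom_compose[OF EB poisson_hom_compose[OF \<phi> AB.PA.tens_one_right_poisson_hom]] .
  have \<beta>_EB: "?EA (\<psi> u) = \<beta> (?EB u)" if "u \<in> carrier ?TB" for u
    unfolding \<beta>_def by (rule BA.slice_transfer[OF \<psi> \<theta> \<epsilon>' \<epsilon> _ that]) (simp_all add: \<epsilon>'_def)
  have \<beta>\<gamma>: "\<beta> (\<gamma> a) = a" if a: "a \<in> carrier A" for a
  proof -
    have "\<beta> (\<gamma> a) = ?EA (\<psi> (\<phi> (?\<iota>A a)))"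
      unfolding \<gamma>_def using a poisson_homD(1)[OF \<phi>] by (simp add: \<beta>_EB)
    then show ?thesis using a by (simp add: \<psi>\<phi> EA_\<iota>)
  qed

  \<comment> \<open>\<open>\<Gamma> = \<beta> \<otimes> id\<close>; since \<open>\<beta>\<close> is onto, so is \<open>\<Gamma>\<close>, and \<open>\<Gamma> \<circ> \<phi>\<close> preserves the center.\<close>
  obtain \<Gamma> where \<Gamma>: "\<Gamma> \<in> poisson_hom K ?TB ?TA"
    "\<And>b r. \<lbrakk>b \<in> carrier B; r \<in> carrier R\<rbrakk> \<Longrightarrow> \<Gamma> (AB.PB.tens b r) = AB.PA.tens (\<beta> b) r"
    using BA.tensor_map[OF \<beta>] by blast
  have "carrier A \<subseteq> \<beta> ` carrier B"
    using \<beta>\<gamma> poisson_homD(1)[OF \<gamma>] by force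
  then have \<Gamma>_surj: "\<Gamma> ` carrier ?TB = carrier ?TA"
    using BA.tensor_map_surj[OF \<Gamma>] by blast
  have "\<forall>r\<in>carrier R. \<exists>s\<in>carrier R. \<Gamma> (\<phi> (?jA r)) = ?jA s"
    using AB.PA.center_of_tensor[OF center] poisson_hom_center[OF TB TA \<Gamma>(1) \<Gamma>_surj]
      poisson_hom_center[OF TA TB \<phi> \<phi>_surj AB.PA.tens_one_central[OF AB.R_trivial]] by blast
  then obtain \<rho> where \<rho>: "\<And>r. r \<in> carrier R \<Longrightarrow> \<rho> r \<in> carrier R"
      "\<And>r. r \<in> carrier R \<Longrightarrow> \<Gamma> (\<phi> (?jA r)) = ?jA (\<rho> r)"
    by metis
  have \<Gamma>_ring: "\<Gamma> \<in> ring_hom ?TB ?TA" using \<Gamma>(1) by (simp add: poisson_hom_def)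
  have \<rho>_hom: "\<rho> \<in> ring_hom R R"
    by (rule ring_hom_factor[OF R jA ring_hom_trans[OF jA(1) ring_hom_trans[OF \<phi>_ring \<Gamma>_ring]]])
      (simp_all add: \<rho>)
  have \<rho>\<theta>: "\<rho> (\<theta> r) = r" if r: "r \<in> carrier R" for r
  proof (rule inj_onD[OF jA(2)])
    have "?jA (\<rho> (\<theta> r)) = \<Gamma> (\<phi> (\<psi> (?jB r)))" using r \<theta> \<rho> by simp
    also have "\<dots> = ?jA r" using r \<Gamma>(2) poisson_homD(4)[OF \<beta>] by (simp add: \<phi>\<psi>)
    finally show "?jA (\<rho> (\<theta> r)) = ?jA r" .
  qed (use r \<theta> \<rho> in auto)
  \<comment> \<open>The left inverse \<open>\<rho>\<close> of \<open>\<theta>\<close> is onto, hence injective because \<open>R\<close> is Noetherian.\<close>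
  have "\<rho> ` carrier R = carrier R"
  proof
    show "carrier R \<subseteq> \<rho> ` carrier R" using \<rho>\<theta> \<theta>(1) by (metis image_eqI subsetI)
  qed (use \<rho>(1) in blast)
  then have "inj_on \<rho> (carrier R)"
    by (rule noetherian_ring.surjective_endomorphism_inj[OF noetherian \<rho>_hom])
  then have \<theta>\<rho>: "\<theta> (\<rho> r) = r" if "r \<in> carrier R" for r
    using \<rho>\<theta> \<rho>(1) \<theta>(1) that by (meson inj_onD)
  have \<phi>_\<rho>: "\<phi> (?jA r) = ?jB (\<rho> r)" if r: "r \<in> carrier R" for r
  proof -
    have "?jA r = \<psi> (?jB (\<rho> r))" using r \<rho>(1) \<theta>(2)[of "\<rho> r"] by (simp add: \<theta>\<rho>)
    then show ?thesis using r \<rho>(1) by (simp add: \<phi>\<psi>)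
  qed
  have \<gamma>_EA: "?EB (\<phi> t) = \<gamma> (?EA t)" if "t \<in> carrier ?TA" for t
    unfolding \<gamma>_def
    by (rule AB.slice_transfer[OF \<phi> \<rho>(1) \<phi>_\<rho> \<epsilon>(1) \<epsilon>' \<epsilon>'_ring _ that]) (simp_all add: \<epsilon>'_def \<theta>\<rho>)
  have \<gamma>\<beta>: "\<gamma> (\<beta> b) = b" if b: "b \<in> carrier B" for b
  proof -
    have "\<gamma> (\<beta> b) = ?EB (\<phi> (\<psi> (?\<iota>B b)))"
      unfolding \<beta>_def using b poisson_homD(1)[OF \<psi>] by (simp add: \<gamma>_EA)
    then show ?thesis using b by (simp add: \<phi>\<psi> EB_\<iota>)
  qed
  have "bij_betw \<gamma> (carrier A) (carrier B)"
    by (rule bij_betw_byWitness[where f' = \<beta>])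
      (use \<beta>\<gamma> \<gamma>\<beta> poisson_homD(1)[OF \<beta>] poisson_homD(1)[OF \<gamma>] in auto)
  then show ?thesis
    using \<gamma> unfolding poisson_isomorphic_def by (auto simp: poisson_iso_iff)
qed

theorem theorem5p5:
  fixes K :: "'k ring" and A :: "('k, 'a) poisson"
  assumes "field K"
    and "poisson_algebra K A"
    and "trivial_poisson_center K A"
  shows "universally_poisson_cancellative TYPE('b) TYPE('r) K A"
  unfolding universally_poisson_cancellative_def
proof (intro allI impI, elim conjE exE)
  fix B :: "('k, 'b) poisson" and R :: "('k, 'r) poisson" and I
  assume B: "poisson_algebra K B" and R: "poisson_algebra K R" "trivial_bracket R"
    and fg: "finitely_generated_algebra K R"
    and I: "ideal I R" "(\<lambda>k. I +>\<^bsub>R\<^esub> (k \<odot>\<^bsub>R\<^esub> \<one>\<^bsub>R\<^esub>)) \<in> ring_iso K (R Quot I)"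
    and iso: "poisson_isomorphic K (poisson_tensor K A R) (poisson_tensor K B R)"
  have alg: "algebra K R" using R(1) by (simp add: poisson_algebra_def)
  obtain \<epsilon> where \<epsilon>: "\<epsilon> \<in> functionals K R" "\<epsilon> \<in> ring_hom R K"
    using algebra.augmentation_of_ideal[OF alg I] by blast
  have "common_factor K A B R"
    using assms(2) B R by (simp add: common_factor_def common_factor_axioms_def poisson_pair_def)
  then show "poisson_isomorphic K A B"
    using poisson_cancellation[OF _ assms(3) algebra.finitely_generated_noetherian[OF alg assms(1) fg] \<epsilon> iso]
    by blast
qed

end
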